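(* Let $G$ be a finitely generated torsion-free nilpotent group of nilpotency class $c$ with isolated lower central series $G=\sqrt[G]{\gamma_1(G)}\ge\sqrt[G]{\gamma_2(G)}\ge\dots\ge\sqrt[G]{\gamma_{c+1}(G)}=\{e\}$. Let $\varphi\colon G\to G$ be an automorphism such that, for each $1\le k\le c$, the induced automorphism $$\varphi_k\colon\sqrt[G]{\gamma_k(G)}/\sqrt[G]{\gamma_{k+1}(G)}\to\sqrt[G]{\gamma_k(G)}/\sqrt[G]{\gamma_{k+1}(G)}$$ is tame and its Pontryagin dual map $\widehat{\varphi_k}$ is an expansive homeomorphism having the specification property. Then the growth rate $R^\infty(\varphi)$ satisfies $$R^\infty(\varphi)=\exp\Big(\sum_{k=1}^c h(\widehat{\varphi_k})\Big).$$
   Context: For an endomorphism $\varphi$ of a group $G$, elements $x,y\in G$ are $\varphi$-conjugate if $y=g\,x\,\varphi(g^{-1})$ for some $g\in G$; the Reidemeister number $R(\varphi)$ is the number of $\varphi$-conjugacy classes. $\varphi$ is tame if $R(\varphi^n)<\infty$ for all $n\in\mathbb{N}$. The growth rate is $R^\infty(\varphi)=\lim_{n\to\infty}R(\varphi^n)^{1/n}$. The isolator of $H\le G$ is $\sqrt[G]{H}=\{g\in G : g^n\in H\text{ for some }n\in\mathbb{N}\}$; $\gamma_1(G)=G$, $\gamma_{k+1}(G)=[G,\gamma_k(G)]$. The factors of the isolated lower central series of a finitely generated torsion-free nilpotent group are isomorphic to $\mathbb{Z}^{d_k}$. For a finitely generated discrete abelian group $A$, $\widehat{A}$ is the Pontryagin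 dual (unitary characters with compact-open topology, a compact metrizable group), and for an automorphism $\alpha$ of $A$ the dual map is $\widehat{\alpha}(\rho)=\rho\circ\alpha$. A homeomorphism $f$ of a compact metric space $(X,d)$ is expansive if there is $\epsilon>0$ such that for any distinct $x,y\in X$ there is $n\in\mathbb{Z}$ with $d(f^n(x),f^n(y))>\epsilon$. A map $f\colon X\to X$ has the specification property if for every $\epsilon>0$ there is $D\in\mathbb{N}$ such that for all $0\le r<\infty$ and all $(x_1,l_1),\dots,(x_r,l_r)\in X\times\mathbb{N}$ there is $z\in X$ with $f^{L(r+1)}(z)=z$ and $d(f^{L(s)+k}(z),f^k(x_s))<\epsilon$ for $0\le k<l_s$, $s=1,\dots,r$, where $L(s)=l_1+\dots+l_{s-1}+(s-1)D$. The topological entropy of a self-map $f$ of a compact metric space is $h(f)=\lim_{\epsilon\to0}\limsup_{n}\frac1n\log s_n(\epsilon,f)$, where $s_n(\epsilon,f)$ is the largest cardinality of a set $E\subset X$ such that for all $x\ne y$ in $E$ there is $0\le i<n$ with $d(f^i(x),f^i(y))\ge\epsilon$. *)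

theory Defs
  imports
    "HOL-Analysis.Analysis"
    "HOL-Algebra.Coset"
    "HOL-Algebra.Generated_Groups"
begin

section \<open>Reidemeister numbers\<close>

definition twisted_conj :: "('a, 'b) monoid_scheme \<Rightarrow> ('a \<Rightarrow> 'a) \<Rightarrow> ('a \<times> 'a) set" where
  "twisted_conj G \<phi> =
     {(x, y). x \<in> carrier G \<and> y \<in> carrier G \<and>
              (\<exists>g\<in>carrier G. y = g \<otimes>\<^bsub>G\<^esub> x \<otimes>\<^bsub>G\<^esub> \<phi> (inv\<^bsub>G\<^esub> g))}"

definition reidemeister :: "('a, 'b) monoid_scheme \<Rightarrow> ('a \<Rightarrow> 'a) \<Rightarrow> enat" where
  "reidemeister G \<phi> =
     (let C = carrier G // twisted_conj G \<phi> in if finite C then enat (card C) else \<infinity>)"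

text \<open>The exponents range over the positive integers.\<close>

definition tame :: "('a, 'b) monoid_scheme \<Rightarrow> ('a \<Rightarrow> 'a) \<Rightarrow> bool" where
  "tame G \<phi> \<longleftrightarrow> (\<forall>n\<ge>1. reidemeister G (\<phi> ^^ n) < \<infinity>)"

definition enat_root :: "nat \<Rightarrow> enat \<Rightarrow> ereal" where
  "enat_root n m = (case m of enat k \<Rightarrow> ereal (root n (real k)) | \<infinity> \<Rightarrow> \<infinity>)"

text \<open>The limit is taken in the extended reals, so that an infinite Reidemeister number is never
  mistaken for a finite one; a finite \<open>r\<close> is the limit only if \<open>R(\<phi>\<^sup>n)\<close> is eventually finite.\<close>

definition has_growth_rate :: "('a, 'b) monoid_scheme \<Rightarrow> ('a \<Rightarrow> 'a) \<Rightarrow> ereal \<Rightarrow> bool" where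
  "has_growth_rate G \<phi> r \<longleftrightarrow> (\<lambda>n. enat_root n (reidemeister G (\<phi> ^^ n))) \<longlonglongrightarrow> r"

section \<open>Nilpotent groups and the isolated lower central series\<close>

definition finitely_generated :: "('a, 'b) monoid_scheme \<Rightarrow> bool" where
  "finitely_generated G \<longleftrightarrow> (\<exists>S. finite S \<and> S \<subseteq> carrier G \<and> generate G S = carrier G)"

definition torsion_free :: "('a, 'b) monoid_scheme \<Rightarrow> bool" where
  "torsion_free G \<longleftrightarrow>
     (\<forall>g\<in>carrier G. \<forall>n::nat. n > 0 \<longrightarrow> g [^]\<^bsub>G\<^esub> n = \<one>\<^bsub>G\<^esub> \<longrightarrow> g = \<one>\<^bsub>G\<^esub>)"

definition commutator_subgroup :: "('a, 'b) monoid_scheme \<Rightarrow> 'a set \<Rightarrow> 'a set \<Rightarrow> 'a set" where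
  "commutator_subgroup G H K =
     generate G (\<Union>h\<in>H. \<Union>k\<in>K. {h \<otimes>\<^bsub>G\<^esub> k \<otimes>\<^bsub>G\<^esub> inv\<^bsub>G\<^esub> h \<otimes>\<^bsub>G\<^esub> inv\<^bsub>G\<^esub> k})"

text \<open>Indexed from 1, with \<open>\<gamma>\<^sub>1(G) = G\<close>; the value at index 0 is immaterial.\<close>

definition lower_central :: "('a, 'b) monoid_scheme \<Rightarrow> nat \<Rightarrow> 'a set" where
  "lower_central G k = (commutator_subgroup G (carrier G) ^^ (k - 1)) (carrier G)"

definition nilpotent_of_class :: "('a, 'b) monoid_scheme \<Rightarrow> nat \<Rightarrow> bool" where
  "nilpotent_of_class G c \<longleftrightarrow>
     lower_central G (c + 1) = {\<one>\<^bsub>G\<^esub>} \<and> (\<forall>m<c. lower_central G (m + 1) \<noteq> {\<one>\<^bsub>G\<^esub>})"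

definition isolator :: "('a, 'b) monoid_scheme \<Rightarrow> 'a set \<Rightarrow> 'a set" where
  "isolator G H = {g \<in> carrier G. \<exists>n::nat. n > 0 \<and> g [^]\<^bsub>G\<^esub> n \<in> H}"

definition isolated_lcs :: "('a, 'b) monoid_scheme \<Rightarrow> nat \<Rightarrow> 'a set" where
  "isolated_lcs G k = isolator G (lower_central G k)"

definition ilcs_factor :: "('a, 'b) monoid_scheme \<Rightarrow> nat \<Rightarrow> 'a set monoid" where
  "ilcs_factor G k = G\<lparr>carrier := isolated_lcs G k\<rparr> Mod isolated_lcs G (k + 1)"

text \<open>The elements of a factor group are cosets. An automorphism preserves the subgroups of the
  series, so the induced map \<open>Nx \<mapsto> N\<phi>(x)\<close> sends a coset to its image under \<open>\<phi>\<close>.\<close>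

definition induced_map :: "('a \<Rightarrow> 'a) \<Rightarrow> 'a set \<Rightarrow> 'a set" where
  "induced_map \<phi> C = \<phi> ` C"

section \<open>Pontryagin duals of discrete abelian groups\<close>

definition circle_group :: "complex monoid" where
  "circle_group = \<lparr>carrier = sphere 0 1, mult = (*), one = 1\<rparr>"

text \<open>Characters are made extensional so that equality is equality on the group.\<close>

definition characters :: "('a, 'b) monoid_scheme \<Rightarrow> ('a \<Rightarrow> complex) set" where
  "characters A = hom A circle_group \<inter> extensional (carrier A)"

definition compact_open_topology :: "'a topology \<Rightarrow> 'b topology \<Rightarrow> ('a \<Rightarrow> 'b) topology" where
  "compact_open_topology X Y =
     topology_generated_by
       {{f \<in> extensional (topspace X). continuous_map X Y f \<and> f ` K \<subseteq> U} | K U.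
          compactin X K \<and> openin Y U}"

definition dual_topology :: "('a, 'b) monoid_scheme \<Rightarrow> ('a \<Rightarrow> complex) topology" where
  "dual_topology A =
     subtopology
       (compact_open_topology (discrete_topology (carrier A)) (top_of_set (sphere 0 1)))
       (characters A)"

definition dual_map ::
    "('a, 'b) monoid_scheme \<Rightarrow> ('a \<Rightarrow> 'a) \<Rightarrow> ('a \<Rightarrow> complex) \<Rightarrow> ('a \<Rightarrow> complex)" where
  "dual_map A \<alpha> \<rho> = restrict (\<rho> \<circ> \<alpha>) (carrier A)"

section \<open>Dynamics on metric spaces\<close>

definition int_iterate :: "'x set \<Rightarrow> ('x \<Rightarrow> 'x) \<Rightarrow> int \<Rightarrow> 'x \<Rightarrow> 'x" where
  "int_iterate X f n = (if n \<ge> 0 then f ^^ nat n else inv_into X f ^^ nat (- n))"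

definition expansive_homeomorphism ::
    "'x set \<Rightarrow> ('x \<Rightarrow> 'x \<Rightarrow> real) \<Rightarrow> ('x \<Rightarrow> 'x) \<Rightarrow> bool" where
  "expansive_homeomorphism X d f \<longleftrightarrow>
     homeomorphic_map (Metric_space.mtopology X d) (Metric_space.mtopology X d) f \<and>
     (\<exists>\<epsilon>>0. \<forall>x\<in>X. \<forall>y\<in>X. x \<noteq> y \<longrightarrow>
        (\<exists>n::int. d (int_iterate X f n x) (int_iterate X f n y) > \<epsilon>))"

text \<open>\<open>spec_time l D s = l\<^sub>1 + \<dots> + l\<^sub>s\<^sub>-\<^sub>1 + (s - 1)D\<close>, used for \<open>s \<ge> 1\<close>.\<close>

definition spec_time :: "(nat \<Rightarrow> nat) \<Rightarrow> nat \<Rightarrow> nat \<Rightarrow> nat" where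
  "spec_time l D s = (\<Sum>i\<in>{1..<s}. l i) + (s - 1) * D"

definition specification_property ::
    "'x set \<Rightarrow> ('x \<Rightarrow> 'x \<Rightarrow> real) \<Rightarrow> ('x \<Rightarrow> 'x) \<Rightarrow> bool" where
  "specification_property X d f \<longleftrightarrow>
     (\<forall>\<epsilon>>0. \<exists>D\<ge>1. \<forall>(r::nat) (x :: nat \<Rightarrow> 'x) (l :: nat \<Rightarrow> nat).
        (\<forall>s\<in>{1..r}. x s \<in> X \<and> l s \<ge> 1) \<longrightarrow>
        (\<exists>z\<in>X. (f ^^ spec_time l D (r + 1)) z = z \<and>
           (\<forall>s\<in>{1..r}. \<forall>k<l s. d ((f ^^ (spec_time l D s + k)) z) ((f ^^ k) (x s)) < \<epsilon>)))"

definition separated_set ::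
    "'x set \<Rightarrow> ('x \<Rightarrow> 'x \<Rightarrow> real) \<Rightarrow> ('x \<Rightarrow> 'x) \<Rightarrow> nat \<Rightarrow> real \<Rightarrow> 'x set \<Rightarrow> bool" where
  "separated_set X d f n \<epsilon> E \<longleftrightarrow>
     E \<subseteq> X \<and> (\<forall>x\<in>E. \<forall>y\<in>E. x \<noteq> y \<longrightarrow> (\<exists>i<n. d ((f ^^ i) x) ((f ^^ i) y) \<ge> \<epsilon>))"

text \<open>The maximum exists when \<open>X\<close> is compact and \<open>f\<close> is a continuous self-map of \<open>X\<close>.\<close>

definition sep_number ::
    "'x set \<Rightarrow> ('x \<Rightarrow> 'x \<Rightarrow> real) \<Rightarrow> ('x \<Rightarrow> 'x) \<Rightarrow> nat \<Rightarrow> real \<Rightarrow> nat" where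
  "sep_number X d f n \<epsilon> = Max (card ` {E. finite E \<and> separated_set X d f n \<epsilon> E})"

definition topological_entropy ::
    "'x set \<Rightarrow> ('x \<Rightarrow> 'x \<Rightarrow> real) \<Rightarrow> ('x \<Rightarrow> 'x) \<Rightarrow> ereal" where
  "topological_entropy X d f =
     Lim (at_right 0)
       (\<lambda>\<epsilon>::real. limsup (\<lambda>n. ereal (ln (real (sep_number X d f n \<epsilon>)) / real n)))"

definition ereal_exp :: "ereal \<Rightarrow> ereal" where
  "ereal_exp x = (case x of ereal r \<Rightarrow> ereal (exp r) | PInfty \<Rightarrow> \<infinity> | MInfty \<Rightarrow> 0)"

section \<open>Existence of a compatible metric on the dual of a countable group\<close>

lemma compact_open_discrete:
  "compact_open_topology (discrete_topology I) Y = product_topology (\<lambda>_. Y) I"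
  (is "?C = ?P")
proof -
  let ?S = "{{f \<in> extensional I. continuous_map (discrete_topology I) Y f \<and> f ` K \<subseteq> U} | K U.
          compactin (discrete_topology I) K \<and> openin Y U}"
  have eq: "{f \<in> extensional I. continuous_map (discrete_topology I) Y f \<and> f ` K \<subseteq> U}
      = (\<Pi>\<^sub>E i\<in>I. if i \<in> K then U else topspace Y)" if "K \<subseteq> I" "openin Y U" for K U
  proof -
    have "U \<subseteq> topspace Y" using that openin_subset by blast
    then show ?thesis using that(1) by (auto simp: PiE_def image_subset_iff Pi_iff subset_iff; metis)
  qed
  have C: "?C = topology_generated_by ?S"
    by (simp add: compact_open_topology_def)
  have 1: "openin ?P V" if VS: "V \<in> ?S" for V
  proof -
    obtain K U where K: "compactin (discrete_topology I) K" "openin Y U" and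
      V: "V = {f \<in> extensional I. continuous_map (discrete_topology I) Y f \<and> f ` K \<subseteq> U}"
      using VS by (elim CollectE exE conjE) (rule that)
    have K': "K \<subseteq> I" "finite K"
      using K(1) by (auto simp: compactin_discrete_topology)
    have "finite {i \<in> I. (if i \<in> K then U else topspace Y) \<noteq> topspace Y}"
      by (rule finite_subset[OF _ K'(2)]) auto
    then show ?thesis
      unfolding V eq[OF K'(1) K(2)] openin_PiE_gen using K(2) by simp
  qed
  have 2: "openin ?C V" if "openin ?P V" for V
  proof -
    have top: "topspace ?C = topspace ?P"
    proof -
      have "{f \<in> extensional I. continuous_map (discrete_topology I) Y f \<and> f ` {} \<subseteq> topspace Y} \<in> ?S"
        by (intro CollectI exI conjI, rule refl) auto
      then have "topspace ?P \<subseteq> \<Union>?S" using eq[of "{}" "topspace Y"] by auto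
      moreover have "\<Union>?S \<subseteq> topspace ?P" using 1 openin_subset by blast
      ultimately show ?thesis by (simp add: C topology_generated_by_topspace)
    qed
    have "continuous_map ?C ?P id"
    proof (subst continuous_map_componentwise, intro conjI ballI)
      show "id ` topspace ?C \<subseteq> extensional I" unfolding top by (auto simp: PiE_iff)
      fix k assume k: "k \<in> I"
      show "continuous_map ?C Y (\<lambda>x. id x k)"
        unfolding continuous_map_def
      proof (intro conjI allI impI)
        show "(\<lambda>x. id x k) \<in> topspace ?C \<rightarrow> topspace Y"
          unfolding top using k by auto
        fix U assume U: "openin Y U"
        have h1: "{x \<in> topspace ?C. id x k \<in> U} =
           {f \<in> extensional I. continuous_map (discrete_topology I) Y f \<and> f ` {k} \<subseteq> U}"
          unfolding top using k by (auto simp: PiE_def)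
        have "compactin (discrete_topology I) {k}"
          using k by (simp add: compactin_discrete_topology)
        then have h2: "{f \<in> extensional I. continuous_map (discrete_topology I) Y f \<and> f ` {k} \<subseteq> U} \<in> ?S"
          using U by (intro CollectI exI conjI) (rule refl)
        show "openin ?C {x \<in> topspace ?C. id x k \<in> U}"
          unfolding h1 unfolding C by (rule topology_generated_by_Basis[OF h2])
      qed
    qed
    then have "openin ?C {x \<in> topspace ?C. id x \<in> V}"
      using that unfolding continuous_map_def by blast
    moreover have "{x \<in> topspace ?C. id x \<in> V} = V"
      using openin_subset[OF that] top by auto
    ultimately show ?thesis by simp
  qed
  have 3: "openin ?P V" if "openin ?C V" for V
    using that unfolding C openin_topology_generated_by_iff
  proof induction
    case (UN K) then show ?case by blast
  qed (use 1 in auto)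
  show ?thesis using 2 3 by (auto simp: topology_eq)
qed

lemma metrizable_dual_topology:
  assumes "countable (carrier A)"
  shows "\<exists>d. Metric_space (characters A) d \<and>
             Metric_space.mtopology (characters A) d = dual_topology A"
proof -
  have "metrizable_space (product_topology (\<lambda>_. top_of_set (sphere 0 1 :: complex set)) (carrier A))"
    unfolding metrizable_space_product_topology
  proof (intro disjI2 conjI ballI)
    show "countable {i \<in> carrier A. \<nexists>a. topspace (top_of_set (sphere 0 1 :: complex set)) \<subseteq> {a}}"
      by (rule countable_subset[OF _ assms]) blast
  qed (simp add: metrizable_space_subtopology metrizable_space_euclidean)
  then have "metrizable_space (dual_topology A)"
    unfolding dual_topology_def compact_open_discrete by (rule metrizable_space_subtopology)
  then obtain M d where Md: "Metric_space M d" "dual_topology A = Metric_space.mtopology M d"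
    unfolding metrizable_space_def by blast
  have "topspace (dual_topology A) = characters A"
    by (auto simp: dual_topology_def compact_open_discrete characters_def hom_def
          circle_group_def PiE_def)
  with Md have "M = characters A"
    using Metric_space.topspace_mtopology by metis
  with Md show ?thesis by metis
qed

end

theory Submission
  imports Defs "HOL-Algebra.Multiplicative_Group"
begin

text \<open>
  Write \<open>N\<^sub>k\<close> for the terms of the isolated lower central series and \<open>A\<^sub>k\<close> for its factors. The proof
  compares the number of twisted conjugacy classes of \<open>\<phi>\<^sup>n\<close> on \<open>G\<close>, the same numbers for the factors
  \<open>A\<^sub>k\<close>, the numbers of \<open>n\<close>-periodic points of the dual maps, and the entropies of these maps.

  From \<open>G\<close> to the factors. Each \<open>N\<^sub>k\<close> is a normal subgroup, and \<open>N\<^sub>k\<close> is central modulo \<open>N\<^sub>k\<^sub>+\<^sub>1\<close>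
  (\<open>isolated_lcs_commutator\<close>): modulo a term of the lower central series, torsion elements form a
  subgroup, and commutators with roots of central elements are torsion. For a central extension, the
  central subgroup acts on the twisted classes over a given class of the quotient. If twisted
  conjugation in the quotient has trivial stabilisers, two such classes coincide only if they are
  related inside the central subgroup, and Reidemeister numbers multiply
  (\<open>reidemeister_central_extension\<close>). The stabilisers are trivial if \<open>\<phi>\<^sup>n\<close> has no nontrivial fixed
  points on the factors. Thus \<open>R(\<phi>\<^sup>n) = \<Prod>\<^sub>k R(\<phi>\<^sub>k\<^sup>n)\<close> (\<open>reidemeister_isolated_lcs\<close>).

  No fixed points. An element \<open>a\<close> of \<open>A\<^sub>k\<close> that is fixed by \<open>\<phi>\<^sub>k\<^sup>n\<close> defines a continuous invariant
  function \<open>\<rho> \<mapsto> \<rho>(a)\<close> for the \<open>n\<close>-th iterate of the dual map. Specification makes such a function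
  constant, and since characters separate the points of an abelian group, \<open>a\<close> is trivial
  (\<open>periodic_element_trivial\<close>).

  From the factors to the duals. On an abelian group the twisted classes of \<open>\<phi>\<^sub>k\<^sup>n\<close> are the cosets of
  the subgroup of all \<open>g \<phi>\<^sub>k\<^sup>n(g)\<^sup>-\<^sup>1\<close>, while the characters fixed by the \<open>n\<close>-th iterate of the dual map
  are those that are trivial on this subgroup. A finite abelian group has as many characters as elements,
  so \<open>R(\<phi>\<^sub>k\<^sup>n)\<close> is the number of \<open>n\<close>-periodic points of the dual map (\<open>card_fixed_characters\<close>).

  Periodic points and entropy. For an expansive map with specification, the number of \<open>n\<close>-periodic
  points and the maximal size of an \<open>(n, \<epsilon>)\<close>-separated set bound each other up to a bounded shift of
  \<open>n\<close>, and the former is almost supermultiplicative in \<open>n\<close>; so its exponential growth rate exists and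
  is the entropy (\<open>entropy_eq_periodic_growth\<close>). Taking \<open>n\<close>-th roots of the product formula gives the
  theorem.
\<close>

section \<open>Commutators and the lower central series\<close>

definition commutator :: "('a, 'b) monoid_scheme \<Rightarrow> 'a \<Rightarrow> 'a \<Rightarrow> 'a" where
  "commutator G x y = x \<otimes>\<^bsub>G\<^esub> y \<otimes>\<^bsub>G\<^esub> inv\<^bsub>G\<^esub> x \<otimes>\<^bsub>G\<^esub> inv\<^bsub>G\<^esub> y"

lemma commutator_subgroup_alt:
  "commutator_subgroup G H K = generate G {commutator G x y | x y. x \<in> H \<and> y \<in> K}"
  unfolding commutator_subgroup_def commutator_def by (rule arg_cong[of _ _ "generate G"]) blast

lemma (in normal) group_hom_coset: "group_hom G (G Mod H) ((#>) H)"
  using r_coset_hom_Mod factorgroup_is_group is_group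
  by (simp add: group_hom_def group_hom_axioms_def)

lemma (in normal) coset_eq_one_iff: "a \<in> carrier G \<Longrightarrow> H #> a = \<one>\<^bsub>G Mod H\<^esub> \<longleftrightarrow> a \<in> H"
  using coset_join1[OF _ _ subgroup_axioms] coset_join2[OF _ subgroup_axioms] subset by auto

context group
begin

lemma commutator_closed [simp, intro]:
  "x \<in> carrier G \<Longrightarrow> y \<in> carrier G \<Longrightarrow> commutator G x y \<in> carrier G"
  by (simp add: commutator_def)

lemma commutator_eq_one_iff:
  assumes "x \<in> carrier G" "y \<in> carrier G"
  shows "commutator G x y = \<one> \<longleftrightarrow> x \<otimes> y = y \<otimes> x"
proof -
  have "commutator G x y = (x \<otimes> y) \<otimes> inv (y \<otimes> x)"
    using assms by (simp add: commutator_def inv_mult_group m_assoc)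
  then show ?thesis using assms
    by (metis inv_closed inv_inv inv_equality m_closed r_inv)
qed

lemma conjugate_pow:
  assumes "x \<in> carrier G" "u \<in> carrier G"
  shows "(x \<otimes> u \<otimes> inv x) [^] (n::nat) = x \<otimes> u [^] n \<otimes> inv x"
proof (induction n)
  case (Suc n)
  have "x \<otimes> u [^] n \<otimes> inv x \<otimes> (x \<otimes> u \<otimes> inv x) = x \<otimes> (u [^] n \<otimes> (inv x \<otimes> x) \<otimes> u) \<otimes> inv x"
    using assms by (simp add: m_assoc flip: m_assoc[of "inv x" x])
  then show ?case using Suc assms by simp
qed (use assms in simp)

text \<open>Conjugation by \<open>x\<close> turns \<open>u\<close> into \<open>zu\<close> with \<open>z = [x, u]\<close>, and \<open>(zu)\<^sup>n\<close> splits because \<open>z\<close> and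
  \<open>u\<close> commute.\<close>

lemma commutator_pow_right:
  assumes "x \<in> carrier G" "u \<in> carrier G"
    and comm: "commutator G x u \<otimes> u = u \<otimes> commutator G x u"
  shows "commutator G x (u [^] (n::nat)) = commutator G x u [^] n"
proof -
  have xu: "x \<otimes> u \<otimes> inv x = commutator G x u \<otimes> u"
    using assms(1,2) by (simp add: commutator_def m_assoc)
  have "x \<otimes> u [^] n \<otimes> inv x = commutator G x u [^] n \<otimes> u [^] n"
    using conjugate_pow[OF assms(1,2), of n] pow_mult_distrib[OF comm, of n] assms(1,2)
    by (simp add: xu)
  then show ?thesis
    using assms(1,2) by (subst commutator_def) (simp add: m_assoc)
qed

lemma conjugate_commutator:
  assumes "y \<in> carrier G" "x \<in> carrier G" "u \<in> carrier G"
  shows "y \<otimes> commutator G x u \<otimes> inv y = commutator G (y \<otimes> x \<otimes> inv y) (y \<otimes> u \<otimes> inv y)"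
proof -
  have c: "inv y \<otimes> (y \<otimes> z) = z" if "z \<in> carrier G" for z
    using that assms by (simp flip: m_assoc)
  show ?thesis using assms by (simp add: commutator_def inv_mult_group m_assoc c)
qed

lemma commutator_subgroup_normal:
  assumes "K \<lhd> G" shows "commutator_subgroup G (carrier G) K \<lhd> G"
proof -
  interpret K: normal K G by fact
  show ?thesis unfolding commutator_subgroup_alt
  proof (rule normal_generateI)
    fix h g assume "h \<in> {commutator G x y | x y. x \<in> carrier G \<and> y \<in> K}" and g: "g \<in> carrier G"
    then obtain x y where h: "h = commutator G x y" "x \<in> carrier G" "y \<in> K" by blast
    have "g \<otimes> h \<otimes> inv g = commutator G (g \<otimes> x \<otimes> inv g) (g \<otimes> y \<otimes> inv g)"
      using conjugate_commutator[of g x y] h g K.subset by auto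
    moreover have "g \<otimes> y \<otimes> inv g \<in> K" using K.inv_op_closed2 g h by blast
    ultimately show "g \<otimes> h \<otimes> inv g \<in> {commutator G x y | x y. x \<in> carrier G \<and> y \<in> K}"
      using g h by blast
  qed (use K.subset in auto)
qed

lemma commutator_in_commutator_subgroup:
  "x \<in> H \<Longrightarrow> y \<in> K \<Longrightarrow> commutator G x y \<in> commutator_subgroup G H K"
  unfolding commutator_subgroup_alt by (auto intro: generate.incl)

lemma commutator_subgroup_least:
  assumes "subgroup L G" "\<And>x y. x \<in> H \<Longrightarrow> y \<in> K \<Longrightarrow> commutator G x y \<in> L"
  shows "commutator_subgroup G H K \<subseteq> L"
  unfolding commutator_subgroup_alt by (rule generate_subgroup_incl) (use assms in auto)

lemma commutator_subgroup_mono: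
  "K \<subseteq> L \<Longrightarrow> commutator_subgroup G H K \<subseteq> commutator_subgroup G H L"
  unfolding commutator_subgroup_alt by (rule mono_generate) blast

lemma commutator_in_normal:
  assumes "K \<lhd> G" "x \<in> carrier G" "y \<in> K"
  shows "commutator G x y \<in> K"
proof -
  interpret K: normal K G by fact
  show ?thesis unfolding commutator_def
    using K.inv_op_closed2 assms by auto
qed

lemma lower_central_1: "lower_central G (Suc 0) = carrier G"
  by (simp add: lower_central_def)

lemma lower_central_Suc:
  "1 \<le> k \<Longrightarrow> lower_central G (Suc k) = commutator_subgroup G (carrier G) (lower_central G k)"
  by (cases k) (simp_all add: lower_central_def)

lemma lower_central_normal: "1 \<le> k \<Longrightarrow> lower_central G k \<lhd> G"
proof (induction k rule: nat_induct_at_least)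
  case base
  have "carrier G \<lhd> G" by (rule normalI) (auto simp: subgroup_self r_coset_def l_coset_def,
    (metis inv_solve_right m_closed inv_closed m_assoc r_inv r_one)+)
  then show ?case by (simp add: lower_central_1)
qed (simp add: lower_central_Suc commutator_subgroup_normal)

lemma lower_central_decreasing: "1 \<le> k \<Longrightarrow> lower_central G (Suc k) \<subseteq> lower_central G k"
  using commutator_subgroup_least commutator_in_normal lower_central_normal normal_imp_subgroup
  by (metis lower_central_Suc)

lemma iterated_commutator_subgroup_subset:
  assumes "K \<subseteq> carrier G"
  shows "(commutator_subgroup G (carrier G) ^^ j) K \<subseteq> lower_central G (Suc j)"
proof (induction j)
  case (Suc j)
  then show ?case
    by (simp add: lower_central_Suc commutator_subgroup_mono)
qed (simp add: lower_central_1 assms)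

end

lemma (in group_hom) hom_commutator:
  "x \<in> carrier G \<Longrightarrow> y \<in> carrier G \<Longrightarrow> h (commutator G x y) = commutator H (h x) (h y)"
  by (simp add: commutator_def)

text \<open>This serves twice: for the quotient by a term of the series, which is therefore nilpotent, and for
  an automorphism, which therefore preserves the series.\<close>

lemma (in group_hom) lower_central_surj_img:
  assumes "h ` carrier G = carrier H" "1 \<le> k"
  shows "lower_central H k = h ` lower_central G k"
  using assms(2)
proof (induction k rule: nat_induct_at_least)
  case base
  show ?case using assms(1) by (simp add: H.lower_central_1 G.lower_central_1)
next
  case (Suc k)
  let ?L = "lower_central G k"
  have L: "?L \<subseteq> carrier G" using Suc(1) G.lower_central_normal normal_imp_subgroup subgroup.subset by blast
  have "{commutator H x y | x y. x \<in> carrier H \<and> y \<in> lower_central H k}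
      = h ` {commutator G x y | x y. x \<in> carrier G \<and> y \<in> ?L}" (is "?A = h ` ?B")
  proof
    show "?A \<subseteq> h ` ?B"
    proof
      fix z assume "z \<in> ?A"
      then obtain a b where z: "z = commutator H a b" and "a \<in> h ` carrier G" "b \<in> h ` ?L"
        unfolding Suc.IH assms(1) by blast
      then obtain x y where "a = h x" "b = h y" "x \<in> carrier G" "y \<in> ?L" by blast
      with z have "z = h (commutator G x y)" using L hom_commutator[of x y] by auto
      then show "z \<in> h ` ?B" using \<open>x \<in> carrier G\<close> \<open>y \<in> ?L\<close> by blast
    qed
    show "h ` ?B \<subseteq> ?A"
      using L hom_commutator Suc.IH assms(1) by blast
  qed
  moreover have "?B \<subseteq> carrier G" using L by blast
  ultimately show ?case
    unfolding H.lower_central_Suc[OF Suc(1)] G.lower_central_Suc[OF Suc(1)] commutator_subgroup_alt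
    using generate_img[of ?B] by simp
qed

section \<open>Torsion in nilpotent groups\<close>

context group
begin

text \<open>Modulo \<open>[G, K]\<close> the elements of \<open>K\<close> commute with each other, so those whose \<open>n\<close>-th power vanishes
  form a subgroup. It is enough to look at generators of \<open>K\<close>.\<close>

lemma power_in_next_term:
  assumes S: "S \<subseteq> carrier G" "generate G S \<lhd> G"
    and pow: "\<And>s. s \<in> S \<Longrightarrow> s [^] (n::nat) \<in> commutator_subgroup G (carrier G) (generate G S)"
    and u: "u \<in> generate G S"
  shows "u [^] n \<in> commutator_subgroup G (carrier G) (generate G S)"
proof -
  let ?K = "generate G S"
  define K' where "K' = commutator_subgroup G (carrier G) ?K"
  interpret K': normal K' G unfolding K'_def using commutator_subgroup_normal[OF S(2)] .
  interpret \<pi>: group_hom G "G Mod K'" "(#>) K'" by (rule K'.group_hom_coset)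
  have Kc: "x \<in> carrier G" if "x \<in> ?K" for x using that S(1) generate_in_carrier by blast
  have comm: "(K' #> x) \<otimes>\<^bsub>G Mod K'\<^esub> (K' #> y) = (K' #> y) \<otimes>\<^bsub>G Mod K'\<^esub> (K' #> x)"
    if "x \<in> ?K" "y \<in> ?K" for x y
  proof -
    have "commutator G x y \<in> K'"
      unfolding K'_def using that Kc commutator_in_commutator_subgroup by blast
    then show ?thesis
      using \<pi>.H.commutator_eq_one_iff[of "K' #> x" "K' #> y"] that Kc
        K'.coset_eq_one_iff[of "commutator G x y"] \<pi>.hom_commutator[of x y] by (metis commutator_closed \<pi>.hom_closed)
  qed
  have "(K' #> u) [^]\<^bsub>G Mod K'\<^esub> n = \<one>\<^bsub>G Mod K'\<^esub>" using u
  proof induction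
    case one
    show ?case by (metis \<pi>.hom_one \<pi>.H.nat_pow_one)
  next
    case (incl s)
    then have "s \<in> carrier G" using S by blast
    then show ?case using pow[OF incl] K'.coset_eq_one_iff[of "s [^] n"] \<pi>.hom_nat_pow[of s n]
      by (simp add: K'_def)
  next
    case (inv s)
    then have s: "s \<in> carrier G" using S by blast
    then have "(K' #> s) [^]\<^bsub>G Mod K'\<^esub> n = \<one>\<^bsub>G Mod K'\<^esub>"
      using pow[OF inv] K'.coset_eq_one_iff[of "s [^] n"] \<pi>.hom_nat_pow[of s n] by (simp add: K'_def)
    then show ?case using s by (metis \<pi>.H.nat_pow_inv \<pi>.H.inv_one \<pi>.hom_inv \<pi>.hom_closed)
  next
    case (eng a b)
    then show ?case using \<pi>.H.pow_mult_distrib[OF comm[of a b], of n] Kc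
      by (metis \<pi>.H.l_one \<pi>.H.one_closed \<pi>.hom_closed \<pi>.hom_mult)
  qed
  then show ?thesis
    using K'.coset_eq_one_iff[of "u [^] n"] \<pi>.hom_nat_pow[of u n] Kc[OF u] unfolding K'_def by simp
qed

text \<open>An element of \<open>K\<close> is central modulo \<open>[G, K]\<close>. Hence \<open>[x, u]\<close> commutes with \<open>u\<close> there, and
  \<open>[x, u]\<^sup>n\<close> is congruent to \<open>[x, u\<^sup>n]\<close>.\<close>

lemma commutator_pow_cong:
  assumes "K \<lhd> G" "x \<in> carrier G" "u \<in> carrier G" "commutator G x u \<in> K"
    and "commutator G x (u [^] (n::nat)) \<in> commutator_subgroup G (carrier G) K"
  shows "commutator G x u [^] n \<in> commutator_subgroup G (carrier G) K"
proof -
  define K' where "K' = commutator_subgroup G (carrier G) K"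
  interpret K': normal K' G unfolding K'_def using commutator_subgroup_normal[OF assms(1)] .
  interpret \<pi>: group_hom G "G Mod K'" "(#>) K'" by (rule K'.group_hom_coset)
  let ?z = "commutator G x u"
  have z: "?z \<in> carrier G" using assms by simp
  have "commutator G u ?z \<in> K'"
    unfolding K'_def using assms commutator_in_commutator_subgroup by blast
  then have "(K' #> u) \<otimes>\<^bsub>G Mod K'\<^esub> (K' #> ?z) = (K' #> ?z) \<otimes>\<^bsub>G Mod K'\<^esub> (K' #> u)"
    using \<pi>.H.commutator_eq_one_iff[of "K' #> u" "K' #> ?z"] K'.coset_eq_one_iff[of "commutator G u ?z"]
      \<pi>.hom_commutator[of u ?z] z assms(3) by (metis commutator_closed \<pi>.hom_closed)
  then have "commutator (G Mod K') (K' #> x) ((K' #> u) [^]\<^bsub>G Mod K'\<^esub> n)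
     = commutator (G Mod K') (K' #> x) (K' #> u) [^]\<^bsub>G Mod K'\<^esub> n"
    using \<pi>.H.commutator_pow_right[of "K' #> x" "K' #> u" n] assms \<pi>.hom_commutator[of x u] \<pi>.hom_closed
    by metis
  then have "K' #> commutator G x (u [^] n) = K' #> ?z [^] n"
    using assms(2,3) by (metis \<pi>.hom_commutator \<pi>.hom_nat_pow nat_pow_closed z)
  then show ?thesis
    using assms(2,3,5) z K'.coset_eq_one_iff[of "?z [^] n"] K'.coset_eq_one_iff[of "commutator G x (u [^] n)"]
    unfolding K'_def by simp
qed

text \<open>Let \<open>K\<^sub>0\<close> be generated by \<open>S\<close> and \<open>K\<^sub>j\<^sub>+\<^sub>1 = [G, K\<^sub>j]\<close>. If \<open>n\<close> kills \<open>K\<^sub>j\<close> modulo \<open>K\<^sub>j\<^sub>+\<^sub>1\<close>, then it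
  kills the generators \<open>[x, y]\<close> of \<open>K\<^sub>j\<^sub>+\<^sub>1\<close> modulo \<open>K\<^sub>j\<^sub>+\<^sub>2\<close>, because \<open>[x, y]\<^sup>n\<close> is congruent to
  \<open>[x, y\<^sup>n]\<close>. So one power of \<open>n\<close> is spent at each step down to \<open>K\<^sub>m\<close>, which is trivial since it
  lies in the lower central series.\<close>

lemma nilpotent_torsion_generated:
  assumes S: "S \<subseteq> carrier G"
    and conj: "\<And>s g. s \<in> S \<Longrightarrow> g \<in> carrier G \<Longrightarrow> g \<otimes> s \<otimes> inv g \<in> S"
    and pow: "\<And>s. s \<in> S \<Longrightarrow> s [^] (n::nat) \<in> commutator_subgroup G (carrier G) (generate G S)"
    and nil: "lower_central G (Suc m) = {\<one>}"
    and u: "u \<in> generate G S"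
  shows "u [^] (n ^ m) = \<one>"
proof -
  define K where "K j = (commutator_subgroup G (carrier G) ^^ j) (generate G S)" for j
  have K0: "K 0 = generate G S" and KS: "K (Suc j) = commutator_subgroup G (carrier G) (K j)" for j
    by (simp_all add: K_def)
  have normal: "K j \<lhd> G" for j
    by (induction j) (use normal_generateI[OF S conj] in \<open>auto simp: K0 KS commutator_subgroup_normal\<close>)
  have Kc: "K j \<subseteq> carrier G" for j
    using normal normal_imp_subgroup subgroup.subset by blast
  have step: "v [^] n \<in> K (Suc j)" if "v \<in> K j" for v j
    using that
  proof (induction j arbitrary: v)
    case 0
    then show ?case
      using power_in_next_term[OF S _ pow] normal[of 0] by (simp add: K0 KS)
  next
    case (Suc j)
    let ?C = "{commutator G x y | x y. x \<in> carrier G \<and> y \<in> K j}"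
    have gen: "K (Suc j) = generate G ?C" by (simp add: KS commutator_subgroup_alt)
    show ?case unfolding KS[of "Suc j"] unfolding gen
    proof (rule power_in_next_term)
      fix s assume "s \<in> ?C"
      then obtain x y where s: "s = commutator G x y" "x \<in> carrier G" "y \<in> K j" by blast
      have "y [^] n \<in> K (Suc j)" using Suc.IH s by blast
      then have "commutator G x (y [^] n) \<in> commutator_subgroup G (carrier G) (K (Suc j))"
        using commutator_in_commutator_subgroup s(2) by blast
      moreover have "commutator G x y \<in> K (Suc j)"
        using commutator_in_commutator_subgroup s(2,3) by (simp add: KS)
      ultimately show "s [^] n \<in> commutator_subgroup G (carrier G) (generate G ?C)"
        using commutator_pow_cong[OF normal[of "Suc j"], of x y n] s Kc unfolding gen by blast
    qed (use Kc gen Suc.prems normal[of "Suc j"] in auto)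
  qed
  have "u [^] (n ^ j) \<in> K j" for j
  proof (induction j)
    case (Suc j)
    have "u [^] (n ^ Suc j) = (u [^] (n ^ j)) [^] n"
      using u S generate_in_carrier by (simp add: nat_pow_pow mult.commute)
    then show ?case using step[OF Suc] by simp
  qed (use u S generate_in_carrier in \<open>simp add: K0\<close>)
  moreover have "K m \<subseteq> {\<one>}"
    using iterated_commutator_subgroup_subset[of "generate G S" m] generate_incl[OF S] nil K_def by simp
  ultimately show ?thesis by blast
qed

text \<open>The set of all elements of exponent \<open>pq\<close> is closed under conjugation, so every element of the
  subgroup that it generates is torsion.\<close>

lemma nilpotent_torsion_mult:
  assumes nil: "lower_central G (Suc m) = {\<one>}"
    and "x \<in> carrier G" "y \<in> carrier G" "x [^] (p::nat) = \<one>" "y [^] (q::nat) = \<one>" "p > 0" "q > 0"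
  shows "\<exists>n>0. (x \<otimes> y) [^] (n::nat) = \<one>"
proof -
  define S where "S = {s \<in> carrier G. s [^] (p * q) = \<one>}"
  have "x [^] (p * q) = (x [^] p) [^] q" "y [^] (p * q) = (y [^] q) [^] p"
    using assms(2,3) by (simp_all add: nat_pow_pow mult.commute)
  then have "x \<in> S" "y \<in> S" using assms(2-5) by (simp_all add: S_def)
  then have xy: "x \<otimes> y \<in> generate G S" by (intro generate.eng generate.incl)
  have "(x \<otimes> y) [^] ((p * q) ^ m) = \<one>"
  proof (rule nilpotent_torsion_generated[OF _ _ _ nil xy])
    show "g \<otimes> s \<otimes> inv g \<in> S" if "s \<in> S" "g \<in> carrier G" for s g
      using that by (simp add: S_def conjugate_pow)
    show "s [^] (p * q) \<in> commutator_subgroup G (carrier G) (generate G S)" if "s \<in> S" for s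
      using that by (simp add: S_def commutator_subgroup_def generate.one)
  qed (auto simp: S_def)
  then show ?thesis using assms by (intro exI[of _ "(p * q) ^ m"]) simp
qed

text \<open>In particular, roots of central elements are central when there is no torsion. The previous
  argument is run with the commutators \<open>[x, u]\<close> such that \<open>u\<^sup>n\<close> is central: these are closed under
  conjugation, and \<open>[x, u]\<^sup>n\<close> is congruent to \<open>[x, u\<^sup>n] = 1\<close>.\<close>

lemma nilpotent_root_of_central:
  assumes nil: "lower_central G (Suc m) = {\<one>}"
    and "x \<in> carrier G" "u \<in> carrier G" "(n::nat) > 0"
    and central: "\<And>g. g \<in> carrier G \<Longrightarrow> g \<otimes> u [^] n = u [^] n \<otimes> g"
  shows "\<exists>k>0. commutator G x u [^] (k::nat) = \<one>"
proof -
  define U where "U = {u \<in> carrier G. \<forall>g\<in>carrier G. g \<otimes> u [^] n = u [^] n \<otimes> g}"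
  define S where "S = {commutator G x u | x u. x \<in> carrier G \<and> u \<in> U}"
  have Sc: "S \<subseteq> carrier G" by (auto simp: S_def U_def)
  have U_conj: "g \<otimes> v \<otimes> inv g \<in> U" if "v \<in> U" "g \<in> carrier G" for v g
  proof -
    have "g \<otimes> v [^] n \<otimes> inv g = v [^] n"
      using that by (simp add: U_def m_assoc)
    then have "(g \<otimes> v \<otimes> inv g) [^] n = v [^] n"
      using that by (simp add: U_def conjugate_pow)
    then show ?thesis using that by (simp add: U_def)
  qed
  have S_conj: "g \<otimes> s \<otimes> inv g \<in> S" if s: "s \<in> S" and g: "g \<in> carrier G" for s g
  proof -
    obtain y v where "s = commutator G y v" "y \<in> carrier G" "v \<in> U" using s unfolding S_def by blast
    moreover from this have "g \<otimes> s \<otimes> inv g = commutator G (g \<otimes> y \<otimes> inv g) (g \<otimes> v \<otimes> inv g)"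
      using g by (simp add: conjugate_commutator U_def)
    ultimately show ?thesis unfolding S_def using U_conj[of v g] g by blast
  qed
  have S_pow: "s [^] n \<in> commutator_subgroup G (carrier G) (generate G S)" if s: "s \<in> S" for s
  proof -
    obtain y v where yv: "s = commutator G y v" "y \<in> carrier G" "v \<in> U" using s unfolding S_def by blast
    then have "commutator G y (v [^] n) = \<one>" by (subst commutator_eq_one_iff) (auto simp: U_def)
    then have "commutator G y (v [^] n) \<in> commutator_subgroup G (carrier G) (generate G S)"
      by (simp add: commutator_subgroup_def generate.one)
    moreover have "commutator G y v \<in> generate G S" using yv s by (simp add: generate.incl)
    ultimately show ?thesis
      using commutator_pow_cong[OF normal_generateI[OF Sc S_conj], of y v n] yv by (simp add: U_def)
  qed
  have "commutator G x u \<in> S" using assms unfolding S_def U_def by blast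
  then have "commutator G x u [^] (n ^ m) = \<one>"
    by (intro nilpotent_torsion_generated[OF Sc S_conj S_pow nil] generate.incl)
  then show ?thesis using assms(4) by (intro exI[of _ "n ^ m"]) simp
qed

end

section \<open>The isolated lower central series\<close>

context group
begin

lemma isolator_subset: "isolator G H \<subseteq> carrier G" by (auto simp: isolator_def)

lemma subset_isolator: "H \<subseteq> carrier G \<Longrightarrow> H \<subseteq> isolator G H"
  by (force simp: isolator_def intro: exI[of _ "Suc 0"])

lemma lower_central_quotient:
  assumes "1 \<le> k"
  shows "lower_central (G Mod lower_central G k) k = {\<one>\<^bsub>G Mod lower_central G k\<^esub>}"
proof -
  interpret L: normal "lower_central G k" G using lower_central_normal assms .
  interpret \<pi>: group_hom G "G Mod lower_central G k" "(#>) (lower_central G k)" by (rule L.group_hom_coset)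
  have one: "\<one>\<^bsub>G Mod lower_central G k\<^esub> = lower_central G k #> \<one>"
    unfolding one_FactGroup by (rule coset_mult_one[OF L.subset, symmetric])
  have "lower_central (G Mod lower_central G k) k = (#>) (lower_central G k) ` lower_central G k"
    using assms by (intro \<pi>.lower_central_surj_img) (simp_all add: carrier_FactGroup)
  also have "\<dots> = {\<one>\<^bsub>G Mod lower_central G k\<^esub>}"
    using L.coset_eq_one_iff[OF L.mem_carrier] L.one_closed one by (metis (no_types, lifting) image_cong image_constant)
  finally show ?thesis .
qed

text \<open>The isolator is the preimage of the set of torsion elements of a nilpotent quotient.\<close>

lemma isolated_lcs_iff:
  assumes "1 \<le> k" "x \<in> carrier G"
  shows "x \<in> isolated_lcs G k \<longleftrightarrow>
    (\<exists>n>0. (lower_central G k #> x) [^]\<^bsub>G Mod lower_central G k\<^esub> (n::nat) = \<one>\<^bsub>G Mod lower_central G k\<^esub>)"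
proof -
  interpret L: normal "lower_central G k" G using lower_central_normal assms(1) .
  show ?thesis
    by (simp only: L.FactGroup_pow[OF assms(2)] L.coset_eq_one_iff[OF nat_pow_closed[OF assms(2)]]
        isolated_lcs_def isolator_def mem_Collect_eq assms(2) simp_thms)
qed

lemma isolated_lcs_subset: "isolated_lcs G k \<subseteq> carrier G"
  by (simp add: isolated_lcs_def isolator_subset)

text \<open>Modulo \<open>\<gamma>\<^sub>k\<^sub>+\<^sub>1\<close> some power of \<open>u\<close> lies in \<open>\<gamma>\<^sub>k\<close> and is central, so \<open>[x, u]\<close> is torsion there. Hence
  the factors of the isolated series are central in the corresponding quotients of \<open>G\<close>.\<close>

lemma isolated_lcs_commutator:
  assumes k: "1 \<le> k" and x: "x \<in> carrier G" and u: "u \<in> isolated_lcs G k"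
  shows "commutator G x u \<in> isolated_lcs G (Suc k)"
proof -
  let ?L = "lower_central G (Suc k)"
  interpret L: normal ?L G using lower_central_normal by simp
  interpret \<pi>: group_hom G "G Mod ?L" "(#>) ?L" by (rule L.group_hom_coset)
  obtain n :: nat where n: "n > 0" "u [^] n \<in> lower_central G k" and uc: "u \<in> carrier G"
    using u by (auto simp: isolated_lcs_def isolator_def)
  have "\<exists>j>0. commutator (G Mod ?L) (?L #> x) (?L #> u) [^]\<^bsub>G Mod ?L\<^esub> (j::nat) = \<one>\<^bsub>G Mod ?L\<^esub>"
  proof (rule \<pi>.H.nilpotent_root_of_central[OF lower_central_quotient _ _ n(1)])
    fix c assume "c \<in> carrier (G Mod ?L)"
    then obtain g where g: "c = ?L #> g" "g \<in> carrier G" by (auto simp: carrier_FactGroup)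
    have "commutator G g (u [^] n) \<in> ?L"
      using commutator_in_commutator_subgroup n(2) g(2) k by (simp add: lower_central_Suc)
    then have "commutator (G Mod ?L) (?L #> g) (?L #> (u [^] n)) = \<one>\<^bsub>G Mod ?L\<^esub>"
      using L.coset_eq_one_iff[of "commutator G g (u [^] n)"] \<pi>.hom_commutator[of g "u [^] n"] g uc by simp
    then show "c \<otimes>\<^bsub>G Mod ?L\<^esub> (?L #> u) [^]\<^bsub>G Mod ?L\<^esub> n = (?L #> u) [^]\<^bsub>G Mod ?L\<^esub> n \<otimes>\<^bsub>G Mod ?L\<^esub> c"
      using \<pi>.H.commutator_eq_one_iff[of "?L #> g" "?L #> (u [^] n)"] L.FactGroup_pow[OF uc, of n] g uc
        \<pi>.hom_closed nat_pow_closed by metis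
  qed (use x uc in auto)
  then show ?thesis
    using isolated_lcs_iff[of "Suc k" "commutator G x u"] \<pi>.hom_commutator[of x u] x uc by simp
qed

lemma isolated_lcs_decreasing: "1 \<le> k \<Longrightarrow> isolated_lcs G (Suc k) \<subseteq> isolated_lcs G k"
  unfolding isolated_lcs_def isolator_def using lower_central_decreasing[of k] by blast

lemma isolated_lcs_subgroup:
  assumes "1 \<le> k" shows "subgroup (isolated_lcs G k) G"
proof -
  let ?L = "lower_central G k"
  interpret L: normal ?L G using lower_central_normal assms .
  interpret \<pi>: group_hom G "G Mod ?L" "(#>) ?L" by (rule L.group_hom_coset)
  obtain m where m: "k = Suc m" using assms by (cases k) auto
  show ?thesis
  proof (rule subgroupI)
    show "isolated_lcs G k \<noteq> {}"
      using subset_isolator[OF L.subset] L.one_closed unfolding isolated_lcs_def by blast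
    show "inv a \<in> isolated_lcs G k" if "a \<in> isolated_lcs G k" for a
      using that L.m_inv_closed by (auto simp: isolated_lcs_def isolator_def nat_pow_inv)
    show "a \<otimes> b \<in> isolated_lcs G k" if a: "a \<in> isolated_lcs G k" and b: "b \<in> isolated_lcs G k" for a b
    proof -
      have ab: "a \<in> carrier G" "b \<in> carrier G" using a b isolated_lcs_subset by auto
      obtain p q :: nat where pq: "p > 0" "q > 0" "(?L #> a) [^]\<^bsub>G Mod ?L\<^esub> p = \<one>\<^bsub>G Mod ?L\<^esub>"
        "(?L #> b) [^]\<^bsub>G Mod ?L\<^esub> q = \<one>\<^bsub>G Mod ?L\<^esub>"
        using a b isolated_lcs_iff[OF assms] ab by metis
      have "\<exists>n>0. ((?L #> a) \<otimes>\<^bsub>G Mod ?L\<^esub> (?L #> b)) [^]\<^bsub>G Mod ?L\<^esub> (n::nat) = \<one>\<^bsub>G Mod ?L\<^esub>"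
        by (rule \<pi>.H.nilpotent_torsion_mult[OF _ _ _ pq(3,4,1,2)])
           (use lower_central_quotient[OF assms] m ab \<pi>.hom_closed in auto)
      then show ?thesis
        using isolated_lcs_iff[OF assms, of "a \<otimes> b"] ab by (simp only: \<pi>.hom_mult m_closed)
    qed
  qed (rule isolated_lcs_subset)
qed

lemma isolated_lcs_normal:
  assumes "1 \<le> k" shows "isolated_lcs G k \<lhd> G"
proof (rule normal_invI[OF isolated_lcs_subgroup[OF assms]])
  interpret N: subgroup "isolated_lcs G k" G by (rule isolated_lcs_subgroup[OF assms])
  fix x h assume x: "x \<in> carrier G" and h: "h \<in> isolated_lcs G k"
  have "x \<otimes> h \<otimes> inv x = commutator G x h \<otimes> h"
    using x h N.mem_carrier by (simp add: commutator_def m_assoc)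
  then show "x \<otimes> h \<otimes> inv x \<in> isolated_lcs G k"
    using isolated_lcs_commutator[OF assms x h] isolated_lcs_decreasing[OF assms] h by auto
qed

lemma isolated_lcs_1: "isolated_lcs G (Suc 0) = carrier G"
  using isolated_lcs_subset[of "Suc 0"] subset_isolator[OF subset_refl]
  unfolding isolated_lcs_def lower_central_1 by (rule equalityI)

lemma isolated_lcs_last:
  assumes "torsion_free G" "nilpotent_of_class G c"
  shows "isolated_lcs G (Suc c) = {\<one>}"
proof
  show "isolated_lcs G (Suc c) \<subseteq> {\<one>}"
    using assms by (auto simp: isolated_lcs_def isolator_def torsion_free_def nilpotent_of_class_def)
  show "{\<one>} \<subseteq> isolated_lcs G (Suc c)"
    using subgroup.one_closed[OF isolated_lcs_subgroup[of "Suc c"]] by simp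
qed

lemma isolated_lcs_iso_image:
  assumes "\<phi> \<in> iso G G" "1 \<le> k"
  shows "\<phi> ` isolated_lcs G k = isolated_lcs G k"
proof -
  have hom: "\<phi> \<in> hom G G" and bij: "bij_betw \<phi> (carrier G) (carrier G)" using assms(1) by (auto simp: iso_def)
  interpret \<phi>: group_hom G G \<phi> using hom is_group by (simp add: group_hom_def group_hom_axioms_def)
  have img: "\<phi> ` lower_central G k = lower_central G k"
    using \<phi>.lower_central_surj_img[OF bij_betw_imp_surj_on[OF bij] assms(2)] by simp
  have L: "lower_central G k \<subseteq> carrier G"
    using lower_central_normal[OF assms(2)] normal_imp_subgroup subgroup.subset by blast
  have "\<phi> x \<in> lower_central G k \<longleftrightarrow> x \<in> lower_central G k" if "x \<in> carrier G" for x
    using inj_on_image_mem_iff[OF bij_betw_imp_inj_on[OF bij] that L] img by simp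
  then have "\<phi> x \<in> isolated_lcs G k \<longleftrightarrow> x \<in> isolated_lcs G k" if "x \<in> carrier G" for x
    using that \<phi>.hom_nat_pow[of x] by (simp add: isolated_lcs_def isolator_def flip: \<phi>.hom_nat_pow)
  then show ?thesis
    using isolated_lcs_subset[of k] bij_betw_imp_surj_on[OF bij] by (auto simp: image_iff subset_iff) (metis imageE)
qed

end

section \<open>Transversals of equivalence relations\<close>

text \<open>Classes are counted by representatives in the group itself, because the representatives for a
  central extension are simply the products of those for its two layers.\<close>

definition transversal :: "'a set \<Rightarrow> ('a \<times> 'a) set \<Rightarrow> 'a set \<Rightarrow> bool" where
  "transversal X r T \<longleftrightarrow> T \<subseteq> X \<and> (\<forall>x\<in>X. \<exists>t\<in>T. (x, t) \<in> r) \<and> (\<forall>s\<in>T. \<forall>t\<in>T. (s, t) \<in> r \<longrightarrow> s = t)"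

lemma transversal_bij_betw_quotient:
  assumes "equiv X r" "transversal X r T"
  shows "bij_betw (\<lambda>t. r `` {t}) T (X // r)"
  unfolding bij_betw_def
proof
  show "inj_on (\<lambda>t. r `` {t}) T"
    using assms eq_equiv_class[OF _ assms(1)] by (intro inj_onI) (auto simp: transversal_def subset_iff)
  show "(\<lambda>t. r `` {t}) ` T = X // r"
  proof (intro equalityI subsetI)
    fix c assume "c \<in> X // r"
    then obtain x where x: "x \<in> X" "c = r `` {x}" by (auto elim: quotientE)
    then obtain t where "t \<in> T" "(x, t) \<in> r" using assms(2) by (auto simp: transversal_def)
    then show "c \<in> (\<lambda>t. r `` {t}) ` T" using x equiv_class_eq[OF assms(1)] by blast
  qed (use assms(2) in \<open>auto simp: transversal_def intro: quotientI\<close>)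
qed

lemma transversal_exists:
  assumes "equiv X r" shows "\<exists>T. transversal X r T"
proof -
  define f where "f x = (SOME t. t \<in> r `` {x})" for x
  have f: "(x, f x) \<in> r" if "x \<in> X" for x
    using someI[of "\<lambda>t. t \<in> r `` {x}" x] equiv_class_self[OF assms that] by (simp add: f_def)
  have eq: "f x = f y" if "(x, y) \<in> r" for x y
    unfolding f_def using equiv_class_eq[OF assms that] by simp
  have "transversal X r (f ` X)"
    unfolding transversal_def
  proof (intro conjI ballI impI)
    show "f ` X \<subseteq> X" using f assms by (auto simp: equiv_def refl_on_def)
    fix s t assume "s \<in> f ` X" "t \<in> f ` X" "(s, t) \<in> r"
    then obtain x y where xy: "x \<in> X" "y \<in> X" "s = f x" "t = f y" by blast
    have "f x = f (f x)" "f y = f (f y)" using eq f xy by blast+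
    then show "s = t" using eq[OF \<open>(s, t) \<in> r\<close>] xy by simp
  qed (use f in blast)
  then show ?thesis by blast
qed

text \<open>Twisted conjugacy in a quotient is studied through its preimage in the group; the next lemma
  carries representatives back to the quotient.\<close>

lemma transversal_image:
  assumes "transversal X r T" "p ` X = Y"
    and "\<And>x y. x \<in> X \<Longrightarrow> y \<in> X \<Longrightarrow> (p x, p y) \<in> s \<longleftrightarrow> (x, y) \<in> r"
    and "\<And>y. y \<in> Y \<Longrightarrow> (y, y) \<in> s"
  shows "transversal Y s (p ` T)" "inj_on p T"
proof -
  have TX: "T \<subseteq> X" using assms(1) by (simp add: transversal_def)
  show "inj_on p T"
  proof (rule inj_onI)
    fix x y assume xy: "x \<in> T" "y \<in> T" "p x = p y"
    then have "(p x, p y) \<in> s" using assms(2,4) TX by (metis imageI subsetD)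
    then have "(x, y) \<in> r" using assms(3) xy TX by blast
    then show "x = y" using xy assms(1) by (auto simp: transversal_def)
  qed
  show "transversal Y s (p ` T)"
    unfolding transversal_def
  proof (intro conjI ballI impI)
    show "p ` T \<subseteq> Y" using TX assms(2) by blast
    fix y assume "y \<in> Y"
    then obtain x where x: "x \<in> X" "y = p x" using assms(2) by blast
    then obtain t where "t \<in> T" "(x, t) \<in> r" using assms(1) by (auto simp: transversal_def)
    then show "\<exists>t\<in>p ` T. (y, t) \<in> s" using x assms(3) TX by blast
  next
    fix y z assume "y \<in> p ` T" "z \<in> p ` T" "(y, z) \<in> s"
    then obtain a b where "y = p a" "z = p b" "a \<in> T" "b \<in> T" by blast
    with \<open>(y, z) \<in> s\<close> have "(a, b) \<in> r" using assms(3) TX by blast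
    then show "y = z" using \<open>y = p a\<close> \<open>z = p b\<close> \<open>a \<in> T\<close> \<open>b \<in> T\<close> assms(1) by (auto simp: transversal_def)
  qed
qed

section \<open>Twisted conjugacy in central extensions\<close>

lemma induced_map_funpow: "induced_map \<phi> ^^ n = induced_map (\<phi> ^^ n)"
proof (induction n)
  case 0
  show ?case by (simp add: induced_map_def fun_eq_iff)
next
  case (Suc n)
  have "induced_map \<phi> (induced_map (\<phi> ^^ n) C) = induced_map (\<phi> ^^ Suc n) C" for C
    by (simp add: induced_map_def image_image)
  then show ?case by (simp add: Suc fun_eq_iff o_def)
qed

lemma (in group) equiv_twisted_conj:
  assumes "\<psi> \<in> hom G G" shows "equiv (carrier G) (twisted_conj G \<psi>)"
proof -
  interpret \<psi>: group_hom G G \<psi> using assms is_group by (simp add: group_hom_def group_hom_axioms_def)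
  show ?thesis
  proof (rule equivI)
    show "refl_on (carrier G) (twisted_conj G \<psi>)"
      by (auto simp: refl_on_def twisted_conj_def intro!: bexI[of _ \<one>])
    show "sym (twisted_conj G \<psi>)"
    proof (rule symI)
      fix x y assume "(x, y) \<in> twisted_conj G \<psi>"
      then obtain g where g: "x \<in> carrier G" "y \<in> carrier G" "g \<in> carrier G" "y = g \<otimes> x \<otimes> \<psi> (inv g)"
        by (auto simp: twisted_conj_def)
      then have "x = inv g \<otimes> y \<otimes> \<psi> (inv (inv g))" by (simp add: m_assoc flip: m_assoc[of "inv g" g])
      then show "(y, x) \<in> twisted_conj G \<psi>"
        unfolding twisted_conj_def using g(1-3) inv_closed[OF g(3)] by blast
    qed
    show "trans (twisted_conj G \<psi>)"
    proof (rule transI)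
      fix x y z assume "(x, y) \<in> twisted_conj G \<psi>" "(y, z) \<in> twisted_conj G \<psi>"
      then obtain g h where g: "x \<in> carrier G" "z \<in> carrier G" "g \<in> carrier G" "h \<in> carrier G"
        "z = h \<otimes> (g \<otimes> x \<otimes> \<psi> (inv g)) \<otimes> \<psi> (inv h)" by (auto simp: twisted_conj_def)
      then have "z = (h \<otimes> g) \<otimes> x \<otimes> \<psi> (inv (h \<otimes> g))" by (simp add: inv_mult_group m_assoc)
      then show "(x, z) \<in> twisted_conj G \<psi>"
        unfolding twisted_conj_def using g(1-4) m_closed[OF g(4,3)] by blast
    qed
    show "twisted_conj G \<psi> \<subseteq> carrier G \<times> carrier G" by (auto simp: twisted_conj_def)
  qed
qed

lemma (in group) reidemeister_transversal:
  assumes "\<psi> \<in> hom G G" "transversal (carrier G) (twisted_conj G \<psi>) T"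
  shows "reidemeister G \<psi> = (if finite T then enat (card T) else \<infinity>)"
  using bij_betw_finite[OF transversal_bij_betw_quotient[OF equiv_twisted_conj[OF assms(1)] assms(2)]]
    bij_betw_same_card[OF transversal_bij_betw_quotient[OF equiv_twisted_conj[OF assms(1)] assms(2)]]
  by (simp add: reidemeister_def)

context normal
begin

lemma coset_eq_iff:
  assumes "x \<in> carrier G" "y \<in> carrier G"
  shows "H #> x = H #> y \<longleftrightarrow> x \<otimes> inv y \<in> H"
proof -
  interpret \<pi>: group_hom G "G Mod H" "(#>) H" by (rule group_hom_coset)
  have "H #> x = H #> y \<longleftrightarrow> H #> (x \<otimes> inv y) = \<one>\<^bsub>G Mod H\<^esub>"
    using assms \<pi>.hom_closed by (metis \<pi>.H.inv_equality \<pi>.H.inv_inv \<pi>.H.r_inv \<pi>.hom_inv \<pi>.hom_mult inv_closed)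
  then show ?thesis by (simp only: coset_eq_one_iff m_closed inv_closed assms)
qed

lemma induced_map_coset:
  assumes "\<psi> \<in> hom G G" "\<psi> ` H = H" "x \<in> carrier G"
  shows "induced_map \<psi> (H #> x) = H #> \<psi> x"
proof -
  have "induced_map \<psi> (H #> x) = (\<lambda>h. \<psi> (h \<otimes> x)) ` H"
    by (auto simp: induced_map_def r_coset_def)
  also have "\<dots> = (\<lambda>h. \<psi> h \<otimes> \<psi> x) ` H"
    using assms hom_mult[OF assms(1)] mem_carrier by (intro image_cong) auto
  also have "\<dots> = (\<lambda>h. h \<otimes> \<psi> x) ` (\<psi> ` H)" by (simp add: image_image)
  also have "\<dots> = H #> \<psi> x" by (auto simp: assms(2) r_coset_def)
  finally show ?thesis .
qed

lemma induced_map_hom: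
  assumes "\<psi> \<in> hom G G" "\<psi> ` H = H"
  shows "induced_map \<psi> \<in> hom (G Mod H) (G Mod H)"
proof (rule homI)
  interpret \<pi>: group_hom G "G Mod H" "(#>) H" by (rule group_hom_coset)
  have \<psi>: "\<psi> x \<in> carrier G" if "x \<in> carrier G" for x using hom_in_carrier[OF assms(1) that] .
  fix X assume X: "X \<in> carrier (G Mod H)"
  then obtain x where x: "X = H #> x" "x \<in> carrier G" by (auto simp: carrier_FactGroup)
  show "induced_map \<psi> X \<in> carrier (G Mod H)"
    using \<pi>.hom_closed[OF \<psi>[OF x(2)]] by (simp add: x induced_map_coset[OF assms])
  fix Y assume "Y \<in> carrier (G Mod H)"
  then obtain y where y: "Y = H #> y" "y \<in> carrier G" by (auto simp: carrier_FactGroup)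
  have "induced_map \<psi> (X \<otimes>\<^bsub>G Mod H\<^esub> Y) = H #> (\<psi> x \<otimes> \<psi> y)"
    using \<pi>.hom_mult[OF x(2) y(2)] induced_map_coset[OF assms, of "x \<otimes> y"] x y hom_mult[OF assms(1) x(2) y(2)]
    by simp
  then show "induced_map \<psi> (X \<otimes>\<^bsub>G Mod H\<^esub> Y) = induced_map \<psi> X \<otimes>\<^bsub>G Mod H\<^esub> induced_map \<psi> Y"
    using \<pi>.hom_mult[OF \<psi>[OF x(2)] \<psi>[OF y(2)]] x y by (simp add: induced_map_coset[OF assms] del: mult_FactGroup)
qed

lemma twisted_conj_cosets:
  assumes "\<psi> \<in> hom G G" "\<psi> ` H = H" "x \<in> carrier G" "y \<in> carrier G"
  shows "(H #> x, H #> y) \<in> twisted_conj (G Mod H) (induced_map \<psi>) \<longleftrightarrow>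
    (\<exists>g\<in>carrier G. H #> y = H #> (g \<otimes> x \<otimes> \<psi> (inv g)))"
proof -
  interpret \<pi>: group_hom G "G Mod H" "(#>) H" by (rule group_hom_coset)
  interpret \<psi>: group_hom G G \<psi> using assms(1) is_group by (simp add: group_hom_def group_hom_axioms_def)
  have "(H #> g) \<otimes>\<^bsub>G Mod H\<^esub> (H #> x) \<otimes>\<^bsub>G Mod H\<^esub> induced_map \<psi> (inv\<^bsub>G Mod H\<^esub> (H #> g))
      = H #> (g \<otimes> x \<otimes> \<psi> (inv g))" if g: "g \<in> carrier G" for g
    using induced_map_coset[OF assms(1,2), of "inv g"] g assms(3)
    by (simp flip: \<pi>.hom_inv \<pi>.hom_mult del: mult_FactGroup \<psi>.hom_inv)
  then show ?thesis
    using assms(3,4) \<pi>.hom_closed by (auto simp: twisted_conj_def carrier_FactGroup simp del: mult_FactGroup)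
qed

end

text \<open>The group \<open>G\<close> acts on the cosets \<open>Nt\<close> by twisted conjugation, and elements of an invariant normal
  subgroup \<open>N\<close> act trivially. When nothing else fixes a coset, the classes over different cosets
  cannot interfere, which makes the numbers of classes multiply.\<close>

definition trivial_twisted_stabilisers :: "('a, 'b) monoid_scheme \<Rightarrow> ('a \<Rightarrow> 'a) \<Rightarrow> 'a set \<Rightarrow> bool" where
  "trivial_twisted_stabilisers G \<psi> N \<longleftrightarrow>
     (\<forall>g\<in>carrier G. \<forall>t\<in>carrier G. N #>\<^bsub>G\<^esub> (g \<otimes>\<^bsub>G\<^esub> t \<otimes>\<^bsub>G\<^esub> \<psi> (inv\<^bsub>G\<^esub> g)) = N #>\<^bsub>G\<^esub> t \<longrightarrow> g \<in> N)"

context group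
begin

context
  fixes M N \<psi>
  assumes M: "M \<lhd> G" and N: "N \<lhd> G" and MN: "M \<subseteq> N"
    and central: "\<And>x u. x \<in> carrier G \<Longrightarrow> u \<in> N \<Longrightarrow> commutator G x u \<in> M"
    and \<psi>: "\<psi> \<in> hom G G" "\<psi> ` M = M" "\<psi> ` N = N"
begin

interpretation M: normal M G by (rule M)
interpretation N: normal N G by (rule N)
interpretation \<psi>: group_hom G G \<psi> using \<psi>(1) is_group by (simp add: group_hom_def group_hom_axioms_def)

lemma central_coset_commute:
  assumes "x \<in> carrier G" "u \<in> N"
  shows "M #> (x \<otimes> u) = M #> (u \<otimes> x)"
proof -
  have u: "u \<in> carrier G" using assms(2) by (rule N.mem_carrier)
  have "x \<otimes> u \<otimes> inv (u \<otimes> x) = commutator G x u"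
    using assms(1) u by (simp add: commutator_def inv_mult_group m_assoc)
  then show ?thesis using M.coset_eq_iff[of "x \<otimes> u" "u \<otimes> x"] central[OF assms] assms(1) u by simp
qed

lemma coset_eq_imp_larger_coset_eq:
  assumes "x \<in> carrier G" "y \<in> carrier G" "M #> x = M #> y" shows "N #> x = N #> y"
  using assms(3) MN unfolding M.coset_eq_iff[OF assms(1,2)] N.coset_eq_iff[OF assms(1,2)] by (rule set_mp[rotated])

lemma coset_mult_cong:
  assumes "M #> x = M #> x'" "M #> y = M #> y'" "x \<in> carrier G" "x' \<in> carrier G" "y \<in> carrier G" "y' \<in> carrier G"
  shows "M #> (x \<otimes> y) = M #> (x' \<otimes> y')"
  using assms group_hom.hom_mult[OF M.group_hom_coset, of x y] group_hom.hom_mult[OF M.group_hom_coset, of x' y']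
  by simp

text \<open>The factor \<open>\<psi>(g\<^sup>-\<^sup>1)\<close> lies in \<open>N\<close>, which is central modulo \<open>M\<close>, so it can be moved past \<open>t\<close>.\<close>

lemma twisted_conj_mult_central:
  assumes "g \<in> N" "a \<in> carrier G" "t \<in> carrier G"
  shows "M #> (g \<otimes> (a \<otimes> t) \<otimes> \<psi> (inv g)) = M #> (g \<otimes> a \<otimes> \<psi> (inv g) \<otimes> t)"
proof -
  have g: "g \<in> carrier G" "\<psi> (inv g) \<in> N" "\<psi> (inv g) \<in> carrier G"
    using assms(1) N.m_inv_closed \<psi>(3) N.mem_carrier by blast+
  have "M #> ((g \<otimes> a) \<otimes> (t \<otimes> \<psi> (inv g))) = M #> ((g \<otimes> a) \<otimes> (\<psi> (inv g) \<otimes> t))"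
    by (rule coset_mult_cong[OF refl central_coset_commute]) (use g assms in auto)
  then show ?thesis using g assms by (simp add: m_assoc)
qed

text \<open>An element \<open>g\<close> that fixes a coset of \<open>M\<close> fixes the coset of \<open>N\<close> containing it, so \<open>g\<close> is in \<open>N\<close>.
  By centrality it then moves \<open>Mt\<close> to \<open>Mg\<psi>(g)\<^sup>-\<^sup>1t\<close>, so \<open>g\<close> is a fixed point of \<open>\<psi>\<close> modulo \<open>M\<close>.\<close>

lemma trivial_twisted_stabilisers_central_extension:
  assumes triv: "trivial_twisted_stabilisers G \<psi> N"
    and fixed: "\<And>g. g \<in> N \<Longrightarrow> M #> \<psi> g = M #> g \<Longrightarrow> g \<in> M"
  shows "trivial_twisted_stabilisers G \<psi> M"
  unfolding trivial_twisted_stabilisers_def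
proof (intro ballI impI)
  fix g t assume g: "g \<in> carrier G" and t: "t \<in> carrier G"
    and eq: "M #> (g \<otimes> t \<otimes> \<psi> (inv g)) = M #> t"
  have \<psi>g: "\<psi> (inv g) \<in> carrier G" using g by (intro \<psi>.hom_closed inv_closed)
  have "N #> (g \<otimes> t \<otimes> \<psi> (inv g)) = N #> t"
    by (rule coset_eq_imp_larger_coset_eq[OF _ t eq]) (intro m_closed g t \<psi>g)
  then have gN: "g \<in> N" by (rule triv[unfolded trivial_twisted_stabilisers_def, rule_format, OF g t])
  have "M #> (g \<otimes> \<psi> (inv g) \<otimes> t) = M #> t"
    using twisted_conj_mult_central[OF gN one_closed t] eq g t by simp
  then have "M #> (g \<otimes> \<psi> (inv g)) = M #> \<one>"
    using M.coset_eq_iff[of "g \<otimes> \<psi> (inv g) \<otimes> t" t] M.coset_eq_iff[of "g \<otimes> \<psi> (inv g)" \<one>] g t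
    by (simp add: m_assoc)
  then have "g \<otimes> inv (\<psi> g) \<in> M" using M.coset_eq_iff[of "g \<otimes> \<psi> (inv g)" \<one>] g by simp
  then have "M #> g = M #> \<psi> g" using M.coset_eq_iff[of g "\<psi> g"] g by simp
  then show "g \<in> M" using fixed gN by simp
qed

text \<open>If \<open>as\<close> and \<open>bt\<close> are twisted conjugate modulo \<open>M\<close> by \<open>g\<close>, then \<open>s\<close> and \<open>t\<close> are so modulo \<open>N\<close>, hence
  equal; the stabiliser condition puts \<open>g\<close> in \<open>N\<close>, the factor \<open>t\<close> cancels by centrality, and \<open>a\<close> and
  \<open>b\<close> are twisted conjugate inside \<open>N\<close>. Conversely every element reaches such a product by two
  successive conjugations, first into \<open>Nt\<close> and then within \<open>N\<close>.\<close>

lemma transversal_central_extension: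
  assumes triv: "trivial_twisted_stabilisers G \<psi> N"
    and T: "transversal (carrier G) {(x, y) \<in> carrier G \<times> carrier G.
              \<exists>g\<in>carrier G. N #> y = N #> (g \<otimes> x \<otimes> \<psi> (inv g))} T"
    and A: "transversal N {(a, b) \<in> N \<times> N. \<exists>g\<in>N. M #> b = M #> (g \<otimes> a \<otimes> \<psi> (inv g))} A"
  defines "r \<equiv> {(x, y) \<in> carrier G \<times> carrier G. \<exists>g\<in>carrier G. M #> y = M #> (g \<otimes> x \<otimes> \<psi> (inv g))}"
  shows "transversal (carrier G) r ((\<lambda>(a, t). a \<otimes> t) ` (A \<times> T))" "inj_on (\<lambda>(a, t). a \<otimes> t) (A \<times> T)"
proof -
  have TG: "t \<in> carrier G" if "t \<in> T" for t using T that by (auto simp: transversal_def)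
  have AN: "a \<in> N" if "a \<in> A" for a using A that by (auto simp: transversal_def)
  note AG = N.mem_carrier[OF AN]
  have sep: "a = b \<and> s = t"
    if abst: "a \<in> A" "b \<in> A" "s \<in> T" "t \<in> T" "g \<in> carrier G"
      and eq: "M #> (b \<otimes> t) = M #> (g \<otimes> (a \<otimes> s) \<otimes> \<psi> (inv g))" for a b s t g
  proof -
    note G = AG[OF abst(1)] AG[OF abst(2)] TG[OF abst(3)] TG[OF abst(4)] abst(5)
    have N1: "N #> (c \<otimes> u) = N #> u" if "c \<in> N" "u \<in> carrier G" for c u
      using N.coset_eq_iff[of "c \<otimes> u" u] that N.mem_carrier by (simp add: m_assoc)
    have "g \<otimes> (a \<otimes> s) \<otimes> \<psi> (inv g) = (g \<otimes> a \<otimes> inv g) \<otimes> (g \<otimes> s \<otimes> \<psi> (inv g))"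
      using G by (simp add: m_assoc flip: m_assoc[of "inv g" g])
    then have "N #> (g \<otimes> (a \<otimes> s) \<otimes> \<psi> (inv g)) = N #> (g \<otimes> s \<otimes> \<psi> (inv g))"
      using N1[of "g \<otimes> a \<otimes> inv g" "g \<otimes> s \<otimes> \<psi> (inv g)"] N.inv_op_closed2[OF abst(5) AN[OF abst(1)]] G by simp
    then have ts: "N #> t = N #> (g \<otimes> s \<otimes> \<psi> (inv g))"
      using coset_eq_imp_larger_coset_eq[OF _ _ eq] N1[OF AN[OF abst(2)], of t] G by simp
    then have "s = t" using T abst G unfolding transversal_def by blast
    then have gN: "g \<in> N" using triv ts G unfolding trivial_twisted_stabilisers_def by metis
    have c: "b = b \<otimes> t \<otimes> inv t" "g \<otimes> a \<otimes> \<psi> (inv g) = g \<otimes> a \<otimes> \<psi> (inv g) \<otimes> t \<otimes> inv t"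
      using G by (simp_all add: m_assoc)
    have "M #> (b \<otimes> t) = M #> (g \<otimes> a \<otimes> \<psi> (inv g) \<otimes> t)"
      using eq twisted_conj_mult_central[OF gN, of a t] G \<open>s = t\<close> by simp
    then have "M #> (b \<otimes> t \<otimes> inv t) = M #> (g \<otimes> a \<otimes> \<psi> (inv g) \<otimes> t \<otimes> inv t)"
      by (rule coset_mult_cong[OF _ refl]) (use G in auto)
    then have "M #> b = M #> (g \<otimes> a \<otimes> \<psi> (inv g))" using c by simp
    then have "a = b" using A abst AN gN unfolding transversal_def by blast
    with \<open>s = t\<close> show ?thesis by simp
  qed
  show "inj_on (\<lambda>(a, t). a \<otimes> t) (A \<times> T)"
  proof (rule inj_onI, clarify)
    fix a s b t assume "a \<in> A" "s \<in> T" "b \<in> A" "t \<in> T" "a \<otimes> s = b \<otimes> t"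
    then show "a = b \<and> s = t" using sep[of a b s t \<one>] AG TG by simp
  qed
  show "transversal (carrier G) r ((\<lambda>(a, t). a \<otimes> t) ` (A \<times> T))"
    unfolding transversal_def
  proof (intro conjI ballI impI)
    show "(\<lambda>(a, t). a \<otimes> t) ` (A \<times> T) \<subseteq> carrier G" using AG TG by auto
  next
    fix x y assume "x \<in> (\<lambda>(a, t). a \<otimes> t) ` (A \<times> T)" "y \<in> (\<lambda>(a, t). a \<otimes> t) ` (A \<times> T)" "(x, y) \<in> r"
    then obtain a s b t g where "x = a \<otimes> s" "y = b \<otimes> t" "a \<in> A" "s \<in> T" "b \<in> A" "t \<in> T"
      "g \<in> carrier G" "M #> y = M #> (g \<otimes> x \<otimes> \<psi> (inv g))" unfolding r_def by auto
    then show "x = y" using sep[of a b s t g] by simp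
  next
    fix x assume x: "x \<in> carrier G"
    then obtain t g where t: "t \<in> T" "g \<in> carrier G" and eq: "N #> t = N #> (g \<otimes> x \<otimes> \<psi> (inv g))"
      using bspec[OF T[unfolded transversal_def, THEN conjunct2, THEN conjunct1] x] by (elim bexE, simp) blast
    note tG = TG[OF t(1)]
    define a where "a = g \<otimes> x \<otimes> \<psi> (inv g) \<otimes> inv t"
    have aN: "a \<in> N" using eq N.coset_eq_iff[of "g \<otimes> x \<otimes> \<psi> (inv g)" t] x t tG by (simp add: a_def)
    have at: "a \<otimes> t = g \<otimes> x \<otimes> \<psi> (inv g)" using x t tG by (simp add: a_def m_assoc)
    obtain b h where b: "b \<in> A" "h \<in> N" and beq: "M #> b = M #> (h \<otimes> a \<otimes> \<psi> (inv h))"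
      using bspec[OF A[unfolded transversal_def, THEN conjunct2, THEN conjunct1] aN] by (elim bexE, simp) blast
    note G = N.mem_carrier[OF aN] AG[OF b(1)] N.mem_carrier[OF b(2)] tG x t(2)
    have "M #> (b \<otimes> t) = M #> (h \<otimes> a \<otimes> \<psi> (inv h) \<otimes> t)"
      by (rule coset_mult_cong[OF beq refl]) (use G in auto)
    also have "\<dots> = M #> (h \<otimes> (a \<otimes> t) \<otimes> \<psi> (inv h))"
      using twisted_conj_mult_central[OF b(2), of a t] G by simp
    also have "h \<otimes> (a \<otimes> t) \<otimes> \<psi> (inv h) = (h \<otimes> g) \<otimes> x \<otimes> \<psi> (inv (h \<otimes> g))"
      using G by (simp add: at inv_mult_group m_assoc)
    finally have "(x, b \<otimes> t) \<in> r" unfolding r_def using G by blast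
    then show "\<exists>z\<in>(\<lambda>(a, t). a \<otimes> t) ` (A \<times> T). (x, z) \<in> r" using b(1) t(1) by force
  qed
qed

lemma reidemeister_central_extension:
  assumes triv: "trivial_twisted_stabilisers G \<psi> N"
    and fin: "reidemeister (G Mod N) (induced_map \<psi>) = enat p"
      "reidemeister (G\<lparr>carrier := N\<rparr> Mod M) (induced_map \<psi>) = enat q"
  shows "reidemeister (G Mod M) (induced_map \<psi>) = enat (p * q)"
proof -
  let ?N = "G\<lparr>carrier := N\<rparr>"
  interpret MN: normal M ?N
    by (rule normal_restrict_supergroup[OF N.subgroup_axioms M MN])
  have \<psi>N: "\<psi> \<in> hom ?N ?N"
  proof (rule homI)
    show "\<psi> x \<in> carrier ?N" if "x \<in> carrier ?N" for x using that \<psi>(3) by auto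
    show "\<psi> (x \<otimes>\<^bsub>?N\<^esub> y) = \<psi> x \<otimes>\<^bsub>?N\<^esub> \<psi> y" if "x \<in> carrier ?N" "y \<in> carrier ?N" for x y
      using that N.mem_carrier by simp
  qed
  define rT where "rT = {(x, y) \<in> carrier G \<times> carrier G. \<exists>g\<in>carrier G. N #> y = N #> (g \<otimes> x \<otimes> \<psi> (inv g))}"
  define rA where "rA = {(a, b) \<in> N \<times> N. \<exists>g\<in>N. M #> b = M #> (g \<otimes> a \<otimes> \<psi> (inv g))}"
  define r where "r = {(x, y) \<in> carrier G \<times> carrier G. \<exists>g\<in>carrier G. M #> y = M #> (g \<otimes> x \<otimes> \<psi> (inv g))}"
  have relT: "(N #> x, N #> y) \<in> twisted_conj (G Mod N) (induced_map \<psi>) \<longleftrightarrow> (x, y) \<in> rT"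
    if "x \<in> carrier G" "y \<in> carrier G" for x y
    using N.twisted_conj_cosets[OF \<psi>(1,3) that] that by (simp add: rT_def)
  have rel: "(M #> x, M #> y) \<in> twisted_conj (G Mod M) (induced_map \<psi>) \<longleftrightarrow> (x, y) \<in> r"
    if "x \<in> carrier G" "y \<in> carrier G" for x y
    using M.twisted_conj_cosets[OF \<psi>(1,2) that] that by (simp add: r_def)
  have relA: "(M #> x, M #> y) \<in> twisted_conj (?N Mod M) (induced_map \<psi>) \<longleftrightarrow> (x, y) \<in> rA"
    if "x \<in> N" "y \<in> N" for x y
    using MN.twisted_conj_cosets[OF \<psi>N \<psi>(2), of x y] that m_inv_consistent[OF N.subgroup_axioms]
    by (auto simp: rA_def r_coset_def)
  have equiv_pullback: "equiv X s" if "equiv Y s'" "p ` X = Y" "s \<subseteq> X \<times> X"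
    "\<And>x y. x \<in> X \<Longrightarrow> y \<in> X \<Longrightarrow> (p x, p y) \<in> s' \<longleftrightarrow> (x, y) \<in> s" for X Y s s' and p :: "'a \<Rightarrow> 'a set"
  proof (rule equivI)
    have s': "refl_on Y s'" "sym s'" "trans s'" using that(1) by (auto elim: equivE)
    show "refl_on X s" using that(2,4) s'(1) by (auto simp: refl_on_def)
    show "sym s"
    proof (rule symI)
      fix x y assume xy: "(x, y) \<in> s"
      then have X: "x \<in> X" "y \<in> X" using that(3) by auto
      then show "(y, x) \<in> s" using symD[OF s'(2)] that(4)[of x y] that(4)[of y x] xy by simp
    qed
    show "trans s"
    proof (rule transI)
      fix x y z assume xyz: "(x, y) \<in> s" "(y, z) \<in> s"
      then have X: "x \<in> X" "y \<in> X" "z \<in> X" using that(3) by auto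
      then show "(x, z) \<in> s"
        using transD[OF s'(3)] that(4)[of x y] that(4)[of y z] that(4)[of x z] xyz by simp
    qed
  qed (rule that(3))
  note eqT = group.equiv_twisted_conj[OF N.factorgroup_is_group N.induced_map_hom[OF \<psi>(1,3)]]
  note eqA = group.equiv_twisted_conj[OF MN.factorgroup_is_group MN.induced_map_hom[OF \<psi>N \<psi>(2)]]
  note eqM = group.equiv_twisted_conj[OF M.factorgroup_is_group M.induced_map_hom[OF \<psi>(1,2)]]
  have imgA: "(#>) M ` N = carrier (?N Mod M)" by (auto simp: carrier_FactGroup r_coset_def)
  obtain T where T: "transversal (carrier G) rT T"
    using transversal_exists[OF equiv_pullback[OF eqT carrier_FactGroup[symmetric] _ relT]] by (auto simp: rT_def)
  obtain A where A: "transversal N rA A"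
    using transversal_exists[OF equiv_pullback[OF eqA imgA _ relA]] by (auto simp: rA_def)
  note AT = transversal_central_extension[OF triv T[unfolded rT_def] A[unfolded rA_def], folded r_def]
  have refl: "(X, X) \<in> s" if "equiv Y s" "X \<in> Y" for X Y and s :: "('a set \<times> 'a set) set"
    using that unfolding equiv_def refl_on_def by blast
  note imgT' = transversal_image[OF T carrier_FactGroup[symmetric] relT refl[OF eqT]]
  note imgA' = transversal_image[OF A imgA relA refl[OF eqA]]
  note img' = transversal_image[OF AT(1) carrier_FactGroup[symmetric] rel refl[OF eqM]]
  have "reidemeister (G Mod N) (induced_map \<psi>) = (if finite ((#>) N ` T) then enat (card ((#>) N ` T)) else \<infinity>)"
    by (rule group.reidemeister_transversal[OF N.factorgroup_is_group N.induced_map_hom[OF \<psi>(1,3)] imgT'(1)])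
  then have T': "finite T" "card T = p"
    using fin(1) by (auto simp: card_image[OF imgT'(2)] finite_image_iff[OF imgT'(2)] split: if_splits)
  have "reidemeister (?N Mod M) (induced_map \<psi>) = (if finite ((#>) M ` A) then enat (card ((#>) M ` A)) else \<infinity>)"
    by (rule group.reidemeister_transversal[OF MN.factorgroup_is_group MN.induced_map_hom[OF \<psi>N \<psi>(2)] imgA'(1)])
  then have A': "finite A" "card A = q"
    using fin(2) by (auto simp: card_image[OF imgA'(2)] finite_image_iff[OF imgA'(2)] split: if_splits)
  let ?AT = "(\<lambda>(a, t). a \<otimes> t) ` (A \<times> T)"
  have "reidemeister (G Mod M) (induced_map \<psi>) = (if finite ((#>) M ` ?AT) then enat (card ((#>) M ` ?AT)) else \<infinity>)"
    by (rule group.reidemeister_transversal[OF M.factorgroup_is_group M.induced_map_hom[OF \<psi>(1,2)] img'(1)])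
  then show ?thesis
    using A' T' by (simp add: card_image[OF img'(2)] card_image[OF AT(2)] card_cartesian_product mult.commute)
qed

end

lemma reidemeister_mod_one:
  assumes "\<psi> \<in> hom G G"
  shows "reidemeister (G Mod {\<one>}) (induced_map \<psi>) = reidemeister G \<psi>"
proof -
  interpret I: normal "{\<one>}" G by (rule one_is_normal)
  interpret \<psi>: group_hom G G \<psi> using assms(1) is_group by (simp add: group_hom_def group_hom_axioms_def)
  have img: "\<psi> ` {\<one>} = {\<one>}" by simp
  obtain T where T: "transversal (carrier G) (twisted_conj G \<psi>) T"
    using transversal_exists[OF equiv_twisted_conj[OF assms]] by blast
  have coset: "{\<one>} #> x = {x}" if "x \<in> carrier G" for x using that by (simp add: r_coset_def)
  have rel: "({\<one>} #> x, {\<one>} #> y) \<in> twisted_conj (G Mod {\<one>}) (induced_map \<psi>) \<longleftrightarrow> (x, y) \<in> twisted_conj G \<psi>"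
    if "x \<in> carrier G" "y \<in> carrier G" for x y
    using I.twisted_conj_cosets[OF assms img that] that by (auto simp: coset twisted_conj_def)
  note eq = I.induced_map_hom[OF assms img]
  have refl: "(X, X) \<in> twisted_conj (G Mod {\<one>}) (induced_map \<psi>)" if "X \<in> carrier (G Mod {\<one>})" for X
    using group.equiv_twisted_conj[OF I.factorgroup_is_group eq] that unfolding equiv_def refl_on_def by blast
  note img' = transversal_image[OF T carrier_FactGroup[symmetric] rel refl]
  show ?thesis
    using reidemeister_transversal[OF assms T] group.reidemeister_transversal[OF I.factorgroup_is_group eq img'(1)]
    by (simp add: card_image[OF img'(2)] finite_image_iff[OF img'(2)])
qed

lemma reidemeister_mod_carrier:
  assumes "\<psi> \<in> hom G G" "\<psi> ` carrier G = carrier G"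
  shows "reidemeister (G Mod carrier G) (induced_map \<psi>) = enat 1"
proof -
  interpret I: normal "carrier G" G using lower_central_normal[of "Suc 0"] by (simp add: lower_central_1)
  have c: "carrier (G Mod carrier G) = {carrier G}"
    unfolding carrier_FactGroup using coset_join2[OF _ subgroup_self] one_closed by (metis (no_types, lifting) image_cong image_constant)
  note hom = I.induced_map_hom[OF assms]
  have "transversal (carrier (G Mod carrier G)) (twisted_conj (G Mod carrier G) (induced_map \<psi>)) {carrier G}"
    using group.equiv_twisted_conj[OF I.factorgroup_is_group hom]
    by (simp add: c transversal_def equiv_def refl_on_def)
  from group.reidemeister_transversal[OF I.factorgroup_is_group hom this] show ?thesis by simp
qed

text \<open>The stabiliser condition is part of the induction: it is needed to count the next layer and is
  passed on by the absence of fixed points in that layer.\<close>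

lemma reidemeister_central_series:
  assumes \<psi>: "\<psi> \<in> hom G G" and N1: "N (Suc 0) = carrier G"
    and normal: "\<And>k. 1 \<le> k \<Longrightarrow> N k \<lhd> G" and inv: "\<And>k. 1 \<le> k \<Longrightarrow> \<psi> ` N k = N k"
    and dec: "\<And>k. 1 \<le> k \<Longrightarrow> N (Suc k) \<subseteq> N k"
    and central: "\<And>k x u. 1 \<le> k \<Longrightarrow> x \<in> carrier G \<Longrightarrow> u \<in> N k \<Longrightarrow> commutator G x u \<in> N (Suc k)"
    and fixed: "\<And>k g. 1 \<le> k \<Longrightarrow> k \<le> c \<Longrightarrow> g \<in> N k \<Longrightarrow> N (Suc k) #> \<psi> g = N (Suc k) #> g \<Longrightarrow> g \<in> N (Suc k)"
    and fin: "\<And>k. 1 \<le> k \<Longrightarrow> k \<le> c \<Longrightarrow>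
      reidemeister (G\<lparr>carrier := N k\<rparr> Mod N (Suc k)) (induced_map \<psi>) = enat (p k)"
  shows "j \<le> c \<Longrightarrow> reidemeister (G Mod N (Suc j)) (induced_map \<psi>) = enat (\<Prod>k=1..j. p k)
    \<and> trivial_twisted_stabilisers G \<psi> (N (Suc j))"
proof (induction j)
  case 0
  show ?case
    using reidemeister_mod_carrier[OF \<psi>] inv[of 1] by (simp add: N1 trivial_twisted_stabilisers_def)
next
  case (Suc j)
  note ext = normal[of "Suc (Suc j)"] normal[of "Suc j"] dec[of "Suc j"] central[of "Suc j"] \<psi>
    inv[of "Suc (Suc j)"] inv[of "Suc j"]
  have IH: "reidemeister (G Mod N (Suc j)) (induced_map \<psi>) = enat (\<Prod>k=1..j. p k)"
    "trivial_twisted_stabilisers G \<psi> (N (Suc j))" using Suc by auto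
  have "reidemeister (G Mod N (Suc (Suc j))) (induced_map \<psi>) = enat ((\<Prod>k=1..j. p k) * p (Suc j))"
    by (rule reidemeister_central_extension[OF ext IH(2,1)]) (use fin Suc.prems in auto)
  moreover have "trivial_twisted_stabilisers G \<psi> (N (Suc (Suc j)))"
    by (rule trivial_twisted_stabilisers_central_extension[OF ext IH(2)]) (use fixed Suc.prems in auto)
  ultimately show ?case by simp
qed

end

section \<open>Characters of abelian groups\<close>

lemma circle_group_simps [simp]:
  "carrier circle_group = sphere 0 1" "mult circle_group = (*)" "one circle_group = 1"
  by (simp_all add: circle_group_def)

lemma comm_group_circle_group: "comm_group circle_group"
proof (rule comm_groupI)
  fix x assume "x \<in> carrier circle_group"
  then have x: "norm x = 1" "x \<noteq> 0" by auto
  then show "\<exists>y\<in>carrier circle_group. y \<otimes>\<^bsub>circle_group\<^esub> x = \<one>\<^bsub>circle_group\<^esub>"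
    by (intro bexI[of _ "inverse x"]) (auto simp: norm_inverse)
qed (auto simp: norm_mult)

interpretation circle: comm_group circle_group by (rule comm_group_circle_group)

lemma circle_nat_pow [simp]: "z [^]\<^bsub>circle_group\<^esub> (n::nat) = z ^ n"
  by (induction n) (auto simp: mult.commute)

text \<open>Adjoining an element to a partial character means choosing a root, and a character that separates
  points needs a root other than 1; for \<open>w = 1\<close> this is where \<open>2 \<le> n\<close> matters.\<close>

lemma circle_root_neq_1:
  fixes w :: complex
  assumes "norm w = 1" "2 \<le> n"
  shows "\<exists>z. norm z = 1 \<and> z ^ n = w \<and> z \<noteq> 1"
proof (cases "w = 1")
  case True
  have "\<not> {z::complex. z ^ n = 1} \<subseteq> {1}"
    using card_complex_roots_unity[of n] card_mono[of "{1::complex}" "{z. z ^ n = 1}"] assms(2) by auto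
  then obtain z :: complex where z: "z ^ n = 1" "z \<noteq> 1" by blast
  then have "norm z ^ n = 1" by (metis norm_one norm_power)
  then have "norm z = 1" using assms(2) power_eq_imp_eq_base[of "norm z" n 1] by simp
  then show ?thesis using z True by blast
next
  case False
  have "cis (Arg w / n) ^ n = cis (real n * (Arg w / n))" by (rule Complex.DeMoivre)
  also have "\<dots> = w" using assms rcis_cmod_Arg[of w] by (simp add: rcis_def)
  finally have "cis (Arg w / n) ^ n = w" .
  moreover from this have "cis (Arg w / n) \<noteq> 1" using False by auto
  ultimately show ?thesis by (intro exI[of _ "cis (Arg w / n)"]) simp
qed

text \<open>A character on a subgroup is represented by its graph, so that extension of characters is inclusion
  and Zorn's lemma applies to a family of sets.\<close>

definition partial_character :: "('a, 'b) monoid_scheme \<Rightarrow> ('a \<times> complex) set \<Rightarrow> bool" where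
  "partial_character A R \<longleftrightarrow> subgroup R (A \<times>\<times> circle_group) \<and> (\<forall>z. (\<one>\<^bsub>A\<^esub>, z) \<in> R \<longrightarrow> z = 1)"

lemma (in comm_group) DirProd_circle: "comm_group (G \<times>\<times> circle_group)"
proof -
  interpret D: group "G \<times>\<times> circle_group" by (rule DirProd_group[OF is_group circle.is_group])
  show ?thesis by (rule D.group_comm_groupI) (auto simp: m_comm)
qed

lemma (in group) group_hom_fst_snd:
  "group_hom (G \<times>\<times> circle_group) G fst" "group_hom (G \<times>\<times> circle_group) circle_group snd"
  using DirProd_group[OF is_group circle.is_group] is_group circle.is_group
  by (auto simp: group_hom_def group_hom_axioms_def hom_def mult_DirProd')

lemma (in group) partial_character_unique:
  assumes "partial_character G R" "(a, z) \<in> R" "(a, w) \<in> R"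
  shows "z = w"
proof -
  have R: "subgroup R (G \<times>\<times> circle_group)" using assms(1) by (simp add: partial_character_def)
  have c: "a \<in> carrier G" "w \<in> carrier circle_group" "z \<in> carrier circle_group"
    using subgroup.subset[OF R] assms by auto
  have "(a, z) \<otimes>\<^bsub>G \<times>\<times> circle_group\<^esub> inv\<^bsub>G \<times>\<times> circle_group\<^esub> (a, w) \<in> R"
    using subgroup.m_closed[OF R] subgroup.m_inv_closed[OF R] assms by blast
  then have "(\<one>, z * inv\<^bsub>circle_group\<^esub> w) \<in> R"
    using c inv_DirProd[OF is_group circle.is_group c(1,2)] by simp
  then have "z \<otimes>\<^bsub>circle_group\<^esub> inv\<^bsub>circle_group\<^esub> w = \<one>\<^bsub>circle_group\<^esub>" using assms(1) by (simp add: partial_character_def)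
  then show ?thesis using c by (metis circle.inv_equality circle.inv_inv circle.inv_closed)
qed

lemma (in comm_group) subgroup_adjoin:
  assumes "subgroup R G" "q \<in> carrier G"
  shows "subgroup {p \<otimes> q [^] (j::int) | p j. p \<in> R} G" (is "subgroup ?R G")
proof -
  interpret R: subgroup R G by fact
  show ?thesis
  proof (rule subgroupI)
    have "\<one> \<otimes> q [^] (0::int) \<in> ?R" using R.one_closed by blast
    then show "?R \<noteq> {}" by blast
    show "inv a \<in> ?R" if "a \<in> ?R" for a
    proof -
      obtain p j where a: "a = p \<otimes> q [^] (j::int)" "p \<in> R" using \<open>a \<in> ?R\<close> by blast
      then have "inv a = inv p \<otimes> q [^] (- j)"
        using assms(2) R.mem_carrier by (simp add: inv_mult int_pow_neg)
      then show ?thesis using a by blast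
    qed
    show "a \<otimes> b \<in> ?R" if "a \<in> ?R" "b \<in> ?R" for a b
    proof -
      obtain p i where a: "a = p \<otimes> q [^] (i::int)" "p \<in> R" using \<open>a \<in> ?R\<close> by blast
      obtain r j where b: "b = r \<otimes> q [^] (j::int)" "r \<in> R" using \<open>b \<in> ?R\<close> by blast
      have "a \<otimes> b = (p \<otimes> r) \<otimes> q [^] (i + j)"
        using a b assms(2) R.mem_carrier by (simp add: int_pow_mult m_ac)
      then show ?thesis using a b by blast
    qed
  qed (use assms(2) R.mem_carrier in auto)
qed

text \<open>The only obstruction to sending \<open>x\<close> to \<open>\<zeta>\<close> is that the value at a power of \<open>x\<close> may be prescribed
  already.\<close>

lemma (in comm_group) partial_character_extend_by:
  assumes R: "partial_character G R" and x: "x \<in> carrier G" and \<zeta>: "\<zeta> \<in> carrier circle_group"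
    and compat: "\<And>(j::int) w. (x [^] j, w) \<in> R \<Longrightarrow> w = \<zeta> [^]\<^bsub>circle_group\<^esub> j"
  shows "\<exists>R'. partial_character G R' \<and> R \<subseteq> R' \<and> (x, \<zeta>) \<in> R'"
proof -
  let ?D = "G \<times>\<times> circle_group"
  interpret D: comm_group ?D by (rule DirProd_circle)
  interpret f: group_hom ?D G fst by (rule group_hom_fst_snd)
  interpret s: group_hom ?D circle_group snd by (rule group_hom_fst_snd)
  interpret R: subgroup R ?D using R by (simp add: partial_character_def)
  have q: "(x, \<zeta>) \<in> carrier ?D" using x \<zeta> by simp
  have qj: "(x, \<zeta>) [^]\<^bsub>?D\<^esub> j = (x [^] j, \<zeta> [^]\<^bsub>circle_group\<^esub> j)" for j :: int
    using f.hom_int_pow[OF q, of j] s.hom_int_pow[OF q, of j] by (simp add: prod_eq_iff)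
  define R' where "R' = {p \<otimes>\<^bsub>?D\<^esub> (x, \<zeta>) [^]\<^bsub>?D\<^esub> (j::int) | p j. p \<in> R}"
  have "z = 1" if one: "(\<one>, z) \<in> R'" for z
  proof -
    obtain p and j :: int where p: "p \<in> R" "(\<one>, z) = p \<otimes>\<^bsub>?D\<^esub> (x [^] j, \<zeta> [^]\<^bsub>circle_group\<^esub> j)"
      using one unfolding R'_def qj by blast
    obtain a w where aw: "p = (a, w)" by fastforce
    have c: "a \<in> carrier G" "w \<in> carrier circle_group" using R.mem_carrier[OF p(1)] aw by auto
    have "a \<otimes> x [^] j = \<one>" and z: "z = w \<otimes>\<^bsub>circle_group\<^esub> \<zeta> [^]\<^bsub>circle_group\<^esub> j" using p(2) by (simp_all add: aw)
    then have "a = x [^] (- j)" using c x by (metis int_pow_closed int_pow_neg inv_equality inv_inv inv_closed)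
    then have "w = \<zeta> [^]\<^bsub>circle_group\<^esub> (- j)" using compat p(1) aw by blast
    then have "z = \<one>\<^bsub>circle_group\<^esub>" unfolding z using \<zeta> by (metis circle.int_pow_neg circle.l_inv circle.int_pow_closed)
    then show ?thesis by simp
  qed
  moreover have "subgroup R' ?D" unfolding R'_def by (rule D.subgroup_adjoin[OF R.subgroup_axioms q])
  moreover have "R \<subseteq> R'"
  proof
    fix p assume p: "p \<in> R"
    then have "p = p \<otimes>\<^bsub>?D\<^esub> (x, \<zeta>) [^]\<^bsub>?D\<^esub> (0::int)" using R.mem_carrier by (simp del: one_DirProd)
    then show "p \<in> R'" unfolding R'_def using p by blast
  qed
  moreover have "(x, \<zeta>) \<in> R'"
  proof -
    have "(x, \<zeta>) = \<one>\<^bsub>?D\<^esub> \<otimes>\<^bsub>?D\<^esub> (x, \<zeta>) [^]\<^bsub>?D\<^esub> (1::int)" using q D.int_pow_1[OF q] D.l_one[OF q] by simp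
    then show ?thesis unfolding R'_def using R.one_closed by blast
  qed
  ultimately show ?thesis unfolding partial_character_def by blast
qed

text \<open>The circle is divisible: if \<open>m\<close> is the least positive exponent with \<open>x\<^sup>m\<close> in the domain, any \<open>m\<close>-th
  root of the value there is admissible. As \<open>x\<close> is not in the domain, \<open>m\<close> is at least 2 and the root
  can avoid 1; if there is no such \<open>m\<close>, every value is admissible.\<close>

lemma (in comm_group) partial_character_extend:
  assumes R: "partial_character G R" and x: "x \<in> carrier G" "x \<notin> fst ` R"
  shows "\<exists>R' \<zeta>. partial_character G R' \<and> R \<subseteq> R' \<and> (x, \<zeta>) \<in> R' \<and> \<zeta> \<noteq> 1"
proof -
  let ?D = "G \<times>\<times> circle_group"
  interpret f: group_hom ?D G fst by (rule group_hom_fst_snd)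
  interpret R: subgroup R ?D using R by (simp add: partial_character_def)
  interpret H: subgroup "fst ` R" G by (rule f.subgroup_img_is_subgroup[OF R.subgroup_axioms])
  have R_int_pow: "(a [^] (j::int), w [^]\<^bsub>circle_group\<^esub> j) \<in> R" if "(a, w) \<in> R" for a w j
  proof -
    interpret s: group_hom ?D circle_group snd by (rule group_hom_fst_snd)
    have aw: "(a, w) \<in> carrier ?D" using R.mem_carrier that by blast
    have "(a, w) [^]\<^bsub>?D\<^esub> j = (a [^] j, w [^]\<^bsub>circle_group\<^esub> j)"
      using f.hom_int_pow[OF aw, of j] s.hom_int_pow[OF aw, of j] by (simp add: prod_eq_iff)
    then show ?thesis using f.G.subgroup_int_pow_closed[OF R.subgroup_axioms that, of j] by simp
  qed
  have "\<exists>\<zeta>\<in>carrier circle_group. \<zeta> \<noteq> 1 \<and>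
    (\<forall>(j::int) w. (x [^] j, w) \<in> R \<longrightarrow> w = \<zeta> [^]\<^bsub>circle_group\<^esub> j)"
  proof (cases "\<exists>n::nat. n > 0 \<and> x [^] n \<in> fst ` R")
    case False
    have "w = (-1) [^]\<^bsub>circle_group\<^esub> j" if jw: "(x [^] j, w) \<in> R" for j :: int and w
    proof -
      have "x [^] j \<in> fst ` R" "x [^] (- j) \<in> fst ` R"
        using jw H.m_inv_closed[of "x [^] j"] x by (force simp: int_pow_neg)+
      then have "x [^] nat \<bar>j\<bar> \<in> fst ` R"
        by (cases "j \<ge> 0") (simp_all flip: int_pow_int)
      then have "j = 0" using False by (metis gr0I nat_0_iff abs_le_zero_iff)
      then show ?thesis using jw R by (simp add: partial_character_def)
    qed
    then show ?thesis by (intro bexI[of _ "-1"]) auto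
  next
    case True
    define m where "m = (LEAST n::nat. n > 0 \<and> x [^] n \<in> fst ` R)"
    have m: "m > 0" "x [^] m \<in> fst ` R" using LeastI_ex[OF True] by (simp_all add: m_def)
    have m_le: "\<not> (0 < n \<and> x [^] n \<in> fst ` R)" if "n < m" for n
      using not_less_Least that unfolding m_def by blast
    obtain w0 where w0: "(x [^] m, w0) \<in> R" using m(2) by auto
    have "m \<noteq> 1" using m(2) x by (metis nat_pow_eone)
    then obtain \<zeta> where \<zeta>: "norm \<zeta> = 1" "\<zeta> ^ m = w0" "\<zeta> \<noteq> 1"
      using circle_root_neq_1[of w0 m] R.mem_carrier[OF w0] m(1) by auto
    have "w = \<zeta> [^]\<^bsub>circle_group\<^esub> j" if jw: "(x [^] j, w) \<in> R" for j :: int and w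
    proof -
      have "x [^] (int m * (j div int m)) \<in> fst ` R"
        using subgroup_int_pow_closed[OF H.subgroup_axioms m(2), of "j div int m"] x(1)
        by (simp add: int_pow_pow flip: int_pow_int)
      moreover have "x [^] j \<in> fst ` R" using jw by force
      moreover have "x [^] (j mod int m) = x [^] j \<otimes> inv (x [^] (int m * (j div int m)))"
        using x(1) by (simp add: minus_mult_div_eq_mod flip: int_pow_diff)
      ultimately have "x [^] (j mod int m) \<in> fst ` R"
        using H.m_closed H.m_inv_closed by presburger
      then have "x [^] nat (j mod int m) \<in> fst ` R"
        using m(1) by (simp flip: int_pow_int)
      moreover have "nat (j mod int m) < m" using m(1) by (simp add: nat_less_iff)
      ultimately have "j mod int m = 0" using m_le m(1) by (metis gr0I nat_0_iff order_antisym pos_mod_sign of_nat_0_less_iff)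
      then have j: "j = int m * (j div int m)" by (metis add.right_neutral mult_div_mod_eq)
      have "(x [^] j, w0 [^]\<^bsub>circle_group\<^esub> (j div int m)) \<in> R"
        using R_int_pow[OF w0, of "j div int m"] x(1) j by (metis int_pow_int int_pow_pow)
      moreover have "w0 [^]\<^bsub>circle_group\<^esub> (j div int m) = \<zeta> [^]\<^bsub>circle_group\<^esub> j"
        using circle.int_pow_pow[of \<zeta> "int m" "j div int m"] \<zeta> j
        by (simp add: int_pow_int)
      ultimately show ?thesis using partial_character_unique[OF R jw] by simp
    qed
    then show ?thesis using \<zeta> by (intro bexI[of _ \<zeta>]) auto
  qed
  then show ?thesis using partial_character_extend_by[OF R x(1)] by meson
qed

text \<open>A partial character defined at \<open>a\<close> with a value other than 1 extends, by Zorn's lemma, to a maximal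
  one, which is defined everywhere.\<close>

lemma (in comm_group) characters_separate:
  assumes a: "a \<in> carrier G" "a \<noteq> \<one>"
  shows "\<exists>\<rho>\<in>characters G. \<rho> a \<noteq> 1"
proof -
  let ?D = "G \<times>\<times> circle_group"
  interpret D: comm_group ?D by (rule DirProd_circle)
  have "partial_character G {\<one>\<^bsub>?D\<^esub>}"
    using D.triv_subgroup unfolding partial_character_def by simp
  then obtain R0 \<zeta> where R0: "partial_character G R0" "(a, \<zeta>) \<in> R0" "\<zeta> \<noteq> 1"
    using partial_character_extend[of "{\<one>\<^bsub>?D\<^esub>}" a] a by auto
  define \<A> where "\<A> = {R. partial_character G R \<and> R0 \<subseteq> R}"
  have "\<exists>M\<in>\<A>. \<forall>X\<in>\<A>. M \<subseteq> X \<longrightarrow> X = M"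
  proof (rule subset_Zorn_nonempty)
    show "\<A> \<noteq> {}" using R0 by (auto simp: \<A>_def)
    fix \<C> assume C: "\<C> \<noteq> {}" "subset.chain \<A> \<C>"
    then have CA: "R \<in> \<C> \<Longrightarrow> R \<in> \<A>" and lin: "R \<in> \<C> \<Longrightarrow> S \<in> \<C> \<Longrightarrow> R \<subseteq> S \<or> S \<subseteq> R" for R S
      by (auto simp: subset_chain_def)
    have sub: "subgroup R ?D" if "R \<in> \<C>" for R using CA[OF that] by (simp add: \<A>_def partial_character_def)
    have "subgroup (\<Union>\<C>) ?D"
    proof (rule D.subgroupI)
      show "\<Union>\<C> \<subseteq> carrier ?D" using sub subgroup.subset by blast
      show "\<Union>\<C> \<noteq> {}" using C(1) subgroup.one_closed[OF sub] by blast
      show "inv\<^bsub>?D\<^esub> p \<in> \<Union>\<C>" if "p \<in> \<Union>\<C>" for p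
      proof -
        obtain R where "R \<in> \<C>" "p \<in> R" using \<open>p \<in> \<Union>\<C>\<close> by blast
        then show ?thesis using subgroup.m_inv_closed[OF sub] by blast
      qed
      show "p \<otimes>\<^bsub>?D\<^esub> q \<in> \<Union>\<C>" if pq: "p \<in> \<Union>\<C>" "q \<in> \<Union>\<C>" for p q
      proof -
        obtain R S where RS: "R \<in> \<C>" "S \<in> \<C>" "p \<in> R" "q \<in> S" using pq by blast
        from lin[OF RS(1,2)] show ?thesis
          using RS subgroup.m_closed[OF sub[OF RS(1)]] subgroup.m_closed[OF sub[OF RS(2)]] by blast
      qed
    qed
    moreover have "z = 1" if "(\<one>, z) \<in> \<Union>\<C>" for z
      using that CA by (auto simp: \<A>_def partial_character_def)
    moreover have "R0 \<subseteq> \<Union>\<C>" using C(1) CA by (auto simp: \<A>_def)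
    ultimately show "\<Union>\<C> \<in> \<A>" by (simp add: \<A>_def partial_character_def)
  qed
  then obtain M where M: "M \<in> \<A>" "\<And>X. X \<in> \<A> \<Longrightarrow> M \<subseteq> X \<Longrightarrow> X = M" by blast
  have PM: "partial_character G M" and R0M: "R0 \<subseteq> M" using M(1) by (auto simp: \<A>_def)
  then have sM: "subgroup M ?D" by (simp add: partial_character_def)
  have total: "x \<in> fst ` M" if xG: "x \<in> carrier G" for x
  proof (rule ccontr)
    assume nx: "x \<notin> fst ` M"
    then obtain R' \<xi> where "partial_character G R'" "M \<subseteq> R'" "(x, \<xi>) \<in> R'"
      using partial_character_extend[OF PM xG nx] by blast
    then have "(x, \<xi>) \<in> M" using M(2)[of R'] R0M by (auto simp: \<A>_def)
    then show False using nx by force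
  qed
  define \<rho> where "\<rho> = restrict (\<lambda>x. THE z. (x, z) \<in> M) (carrier G)"
  have \<rho>: "(x, \<rho> x) \<in> M" if x: "x \<in> carrier G" for x
  proof -
    obtain z where z: "(x, z) \<in> M" using total[OF x] by auto
    then have "(THE z. (x, z) \<in> M) = z" using partial_character_unique[OF PM] by blast
    then show ?thesis using z x by (simp add: \<rho>_def)
  qed
  have \<rho>_eq: "\<rho> x = z" if "(x, z) \<in> M" for x z
    using partial_character_unique[OF PM that \<rho>] subgroup.subset[OF sM] that by auto
  have "\<rho> \<in> hom G circle_group"
  proof (rule homI)
    show "\<rho> x \<in> carrier circle_group" if "x \<in> carrier G" for x
      using \<rho>[OF that] subgroup.subset[OF sM] by auto
    show "\<rho> (x \<otimes> y) = \<rho> x \<otimes>\<^bsub>circle_group\<^esub> \<rho> y" if "x \<in> carrier G" "y \<in> carrier G" for x y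
      using subgroup.m_closed[OF sM \<rho>[OF that(1)] \<rho>[OF that(2)]] by (intro \<rho>_eq) simp
  qed
  then have "\<rho> \<in> characters G" by (simp add: characters_def \<rho>_def)
  moreover have "\<rho> a \<noteq> 1" using \<rho>_eq[of a \<zeta>] R0 R0M by auto
  ultimately show ?thesis by blast
qed

section \<open>Counting characters of abelian groups\<close>

context comm_group
begin

lemma character_mult: "\<rho> \<in> characters G \<Longrightarrow> x \<in> carrier G \<Longrightarrow> y \<in> carrier G \<Longrightarrow> \<rho> (x \<otimes> y) = \<rho> x * \<rho> y"
  by (simp add: characters_def hom_def)

lemma character_norm: "\<rho> \<in> characters G \<Longrightarrow> x \<in> carrier G \<Longrightarrow> norm (\<rho> x) = 1"
  by (auto simp: characters_def hom_def)

lemma character_group_hom: "\<rho> \<in> characters G \<Longrightarrow> group_hom G circle_group \<rho>"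
  by (simp add: characters_def group_hom_def group_hom_axioms_def is_group circle.is_group)

lemma character_one: "\<rho> \<in> characters G \<Longrightarrow> \<rho> \<one> = 1"
  using group_hom.hom_one[OF character_group_hom] by simp

lemma finite_characters:
  assumes "finite (carrier G)" shows "finite (characters G)"
proof (rule finite_subset)
  show "characters G \<subseteq> (\<Pi>\<^sub>E x\<in>carrier G. {z. z ^ order G = 1})"
  proof
    fix \<rho> assume \<rho>: "\<rho> \<in> characters G"
    have "\<rho> x ^ order G = 1" if "x \<in> carrier G" for x
      using group_hom.hom_nat_pow[OF character_group_hom[OF \<rho>] that, of "order G"]
        pow_order_eq_1[OF that] character_one[OF \<rho>] by simp
    then show "\<rho> \<in> (\<Pi>\<^sub>E x\<in>carrier G. {z. z ^ order G = 1})"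
      using \<rho> by (auto simp: characters_def PiE_def)
  qed
  have "1 \<le> order G" using assms order_gt_0_iff_finite by (simp add: Suc_le_eq)
  then show "finite (\<Pi>\<^sub>E x\<in>carrier G. {z::complex. z ^ order G = 1})"
    by (intro finite_PiE assms finite_roots_unity)
qed

definition character_times :: "('a \<Rightarrow> complex) \<Rightarrow> ('a \<Rightarrow> complex) \<Rightarrow> 'a \<Rightarrow> complex" where
  "character_times \<psi> \<rho> = restrict (\<lambda>x. \<psi> x * \<rho> x) (carrier G)"

lemma character_times_bij:
  assumes \<psi>: "\<psi> \<in> characters G"
  shows "bij_betw (character_times \<psi>) (characters G) (characters G)"
proof (rule bij_betwI[where g = "character_times (\<lambda>x. inverse (\<psi> x))"])
  have nz: "\<psi> x \<noteq> 0" if "x \<in> carrier G" for x using character_norm[OF \<psi> that] by auto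
  show "character_times \<psi> \<in> characters G \<rightarrow> characters G"
    using \<psi> by (auto simp: characters_def character_times_def hom_def norm_mult Pi_iff)
  show "character_times (\<lambda>x. inverse (\<psi> x)) \<in> characters G \<rightarrow> characters G"
    using \<psi> by (auto simp: characters_def character_times_def hom_def norm_mult norm_inverse Pi_iff)
  show "character_times (\<lambda>x. inverse (\<psi> x)) (character_times \<psi> \<rho>) = \<rho>"
    if "\<rho> \<in> characters G" for \<rho>
    using that nz by (auto simp: character_times_def characters_def extensional_def fun_eq_iff)
  show "character_times \<psi> (character_times (\<lambda>x. inverse (\<psi> x)) \<rho>) = \<rho>"
    if "\<rho> \<in> characters G" for \<rho>
    using that nz by (auto simp: character_times_def characters_def extensional_def fun_eq_iff)
qed

lemma trivial_character: "restrict (\<lambda>_. 1) (carrier G) \<in> characters G"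
  by (auto simp: characters_def hom_def)

text \<open>Translation by an element \<open>a\<close> multiplies the sum by \<open>\<rho>(a)\<close>, so it vanishes if \<open>\<rho>(a)\<close> is not 1.\<close>

lemma sum_character:
  assumes "finite (carrier G)" "\<rho> \<in> characters G"
  shows "(\<Sum>x\<in>carrier G. \<rho> x) = (if \<rho> = restrict (\<lambda>_. 1) (carrier G) then of_nat (order G) else 0)"
proof (cases "\<forall>x\<in>carrier G. \<rho> x = 1")
  case True
  then have "\<rho> = restrict (\<lambda>_. 1) (carrier G)"
    using assms(2) by (auto simp: characters_def extensional_def fun_eq_iff)
  then show ?thesis using True by (simp add: order_def)
next
  case False
  then obtain a where a: "a \<in> carrier G" "\<rho> a \<noteq> 1" by blast
  have "bij_betw (\<lambda>x. a \<otimes> x) (carrier G) (carrier G)"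
    using a(1) by (intro bij_betwI[where g = "\<lambda>x. inv a \<otimes> x"]) (auto simp flip: m_assoc)
  then have "(\<Sum>x\<in>carrier G. \<rho> (a \<otimes> x)) = (\<Sum>x\<in>carrier G. \<rho> x)"
    by (rule sum.reindex_bij_betw)
  then have "\<rho> a * (\<Sum>x\<in>carrier G. \<rho> x) = (\<Sum>x\<in>carrier G. \<rho> x)"
    using assms(2) a(1) by (simp add: character_mult sum_distrib_left)
  then have "(\<Sum>x\<in>carrier G. \<rho> x) = 0" using a(2) by simp
  then show ?thesis using a by auto
qed

text \<open>The dual orthogonality relation: here a character that separates \<open>x\<close> from 1 is the multiplier.\<close>

lemma sum_over_characters:
  assumes "x \<in> carrier G"
  shows "(\<Sum>\<rho>\<in>characters G. \<rho> x) = (if x = \<one> then of_nat (card (characters G)) else 0)"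
proof (cases "x = \<one>")
  case False
  then obtain \<psi> where \<psi>: "\<psi> \<in> characters G" "\<psi> x \<noteq> 1" using characters_separate assms by blast
  have "(\<Sum>\<rho>\<in>characters G. character_times \<psi> \<rho> x) = (\<Sum>\<rho>\<in>characters G. \<rho> x)"
    by (rule sum.reindex_bij_betw[OF character_times_bij[OF \<psi>(1)], of "\<lambda>\<rho>. \<rho> x"])
  then have "\<psi> x * (\<Sum>\<rho>\<in>characters G. \<rho> x) = (\<Sum>\<rho>\<in>characters G. \<rho> x)"
    using assms by (simp add: character_times_def sum_distrib_left)
  then show ?thesis using \<psi>(2) False by simp
qed (simp add: character_one)

text \<open>Double counting of the sum of all \<open>\<rho>(x)\<close>: only the trivial character contributes when \<open>x\<close> is summed
  first, and only \<open>x = 1\<close> when \<open>\<rho>\<close> is.\<close>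

lemma card_characters:
  assumes "finite (carrier G)" shows "card (characters G) = order G"
proof -
  have "(of_nat (order G) :: complex) = (\<Sum>\<rho>\<in>characters G. if \<rho> = restrict (\<lambda>_. 1) (carrier G) then of_nat (order G) else 0)"
    using finite_characters[OF assms] trivial_character by simp
  also have "\<dots> = (\<Sum>\<rho>\<in>characters G. \<Sum>x\<in>carrier G. \<rho> x)"
    using sum_character[OF assms] by simp
  also have "\<dots> = (\<Sum>x\<in>carrier G. \<Sum>\<rho>\<in>characters G. \<rho> x)" by (rule sum.swap)
  also have "\<dots> = (\<Sum>x\<in>carrier G. if x = \<one> then of_nat (card (characters G)) else 0)"
    using sum_over_characters by simp
  also have "\<dots> = of_nat (card (characters G))" using assms by simp
  finally show ?thesis by simp
qed

end

section \<open>Fixed characters and Reidemeister numbers\<close>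

context comm_group
begin

lemma displacement_subgroup:
  assumes "\<beta> \<in> hom G G" shows "subgroup ((\<lambda>g. g \<otimes> \<beta> (inv g)) ` carrier G) G"
proof -
  interpret \<beta>: group_hom G G \<beta> using assms is_group by (simp add: group_hom_def group_hom_axioms_def)
  have "(\<lambda>g. g \<otimes> \<beta> (inv g)) \<in> hom G G"
    by (rule homI) (auto simp: inv_mult m_ac)
  then interpret h: group_hom G G "\<lambda>g. g \<otimes> \<beta> (inv g)" using is_group by (simp add: group_hom_def group_hom_axioms_def)
  show ?thesis by (rule h.img_is_subgroup)
qed

text \<open>In an abelian group \<open>g x \<beta>(g\<^sup>-\<^sup>1) = (g \<beta>(g\<^sup>-\<^sup>1)) x\<close>, so the classes are cosets of a subgroup.\<close>

lemma twisted_classes_eq_cosets: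
  assumes "\<beta> \<in> hom G G"
  shows "carrier G // twisted_conj G \<beta> = carrier (G Mod (\<lambda>g. g \<otimes> \<beta> (inv g)) ` carrier G)"
proof -
  interpret \<beta>: group_hom G G \<beta> using assms is_group by (simp add: group_hom_def group_hom_axioms_def)
  have "twisted_conj G \<beta> `` {x} = (\<lambda>g. g \<otimes> \<beta> (inv g)) ` carrier G #> x" if x: "x \<in> carrier G" for x
  proof -
    have "g \<otimes> x \<otimes> \<beta> (inv g) = g \<otimes> \<beta> (inv g) \<otimes> x" if "g \<in> carrier G" for g
      using that x by (simp add: m_ac)
    then show ?thesis using x by (auto simp: twisted_conj_def r_coset_def simp del: \<beta>.hom_inv)
  qed
  then show ?thesis by (auto simp: quotient_def carrier_FactGroup)
qed

text \<open>A character is fixed by the dual of \<open>\<beta>\<close> exactly if it is trivial on all \<open>g \<beta>(g\<^sup>-\<^sup>1)\<close>, that is, if it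
  comes from a character of the quotient whose elements are the twisted classes. That quotient is a
  finite abelian group and has as many characters as elements.\<close>

lemma card_fixed_characters:
  assumes \<beta>: "\<beta> \<in> hom G G" and fin: "finite (carrier G // twisted_conj G \<beta>)"
  defines "F \<equiv> {\<rho> \<in> characters G. restrict (\<rho> \<circ> \<beta>) (carrier G) = \<rho>}"
  shows "finite F" "card F = card (carrier G // twisted_conj G \<beta>)"
proof -
  define H where "H = (\<lambda>g. g \<otimes> \<beta> (inv g)) ` carrier G"
  interpret \<beta>: group_hom G G \<beta> using \<beta> is_group by (simp add: group_hom_def group_hom_axioms_def)
  have H: "subgroup H G" unfolding H_def by (rule displacement_subgroup[OF \<beta>])
  then interpret H: normal H G by (rule subgroup_imp_normal)
  interpret Q: comm_group "G Mod H" by (rule abelian_FactGroup[OF H])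
  have classes: "carrier G // twisted_conj G \<beta> = carrier (G Mod H)"
    unfolding H_def by (rule twisted_classes_eq_cosets[OF \<beta>])
  have \<pi>: "(#>) H \<in> hom G (G Mod H)" by (rule H.r_coset_hom_Mod)
  have fixed_iff: "restrict (\<rho> \<circ> \<beta>) (carrier G) = \<rho> \<longleftrightarrow> (\<forall>h\<in>H. \<rho> h = 1)" if \<rho>: "\<rho> \<in> characters G" for \<rho>
  proof -
    interpret \<rho>: group_hom G circle_group \<rho> by (rule character_group_hom[OF \<rho>])
    have "\<rho> (g \<otimes> \<beta> (inv g)) = 1 \<longleftrightarrow> \<rho> (\<beta> g) = \<rho> g" if g: "g \<in> carrier G" for g
    proof -
      have "\<rho> (g \<otimes> \<beta> (inv g)) = \<rho> g \<otimes>\<^bsub>circle_group\<^esub> inv\<^bsub>circle_group\<^esub> \<rho> (\<beta> g)" 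
        using g \<rho>.hom_mult[of g "inv \<beta> g"] \<rho>.hom_inv[of "\<beta> g"] by simp
      moreover have "\<dots> = \<one>\<^bsub>circle_group\<^esub> \<longleftrightarrow> \<rho> g = \<rho> (\<beta> g)"
        using g \<rho>.hom_closed \<beta>.hom_closed circle.inv_equality circle.inv_inv circle.r_inv
        by (metis circle.inv_closed)
      ultimately show ?thesis by auto
    qed
    moreover have "restrict (\<rho> \<circ> \<beta>) (carrier G) = \<rho> \<longleftrightarrow> (\<forall>g\<in>carrier G. \<rho> (\<beta> g) = \<rho> g)"
      using \<rho> by (auto simp: characters_def extensional_def fun_eq_iff)
    ultimately show ?thesis by (simp add: H_def del: \<beta>.hom_inv)
  qed
  define p where "p \<rho> = compose (carrier G) \<rho> ((#>) H)" for \<rho> :: "'a set \<Rightarrow> complex"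
  have "bij_betw p (characters (G Mod H)) F"
    unfolding bij_betw_def
  proof
    show "inj_on p (characters (G Mod H))"
    proof (rule inj_onI)
      fix \<rho> \<psi> assume \<rho>: "\<rho> \<in> characters (G Mod H)" and \<psi>: "\<psi> \<in> characters (G Mod H)" and eq: "p \<rho> = p \<psi>"
      have "\<rho> (H #> x) = \<psi> (H #> x)" if "x \<in> carrier G" for x
        using fun_cong[OF eq, of x] that by (simp add: p_def compose_def)
      then have "\<rho> C = \<psi> C" if "C \<in> carrier (G Mod H)" for C using that by (auto simp: carrier_FactGroup)
      then show "\<rho> = \<psi>"
        using \<rho> \<psi> unfolding characters_def by (intro extensionalityI[of _ "carrier (G Mod H)"]) auto
    qed
    show "p ` characters (G Mod H) = F"
    proof (intro equalityI subsetI)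
      fix \<rho> assume "\<rho> \<in> p ` characters (G Mod H)"
      then obtain \<rho>' where \<rho>': "\<rho>' \<in> characters (G Mod H)" "\<rho> = p \<rho>'" by blast
      have "\<rho> \<in> characters G"
        using \<rho>' hom_compose[OF \<pi>, of \<rho>' circle_group] by (simp add: characters_def p_def)
      moreover have "\<rho> h = 1" if "h \<in> H" for h
        using that \<rho>' H.mem_carrier Q.character_one coset_join2[OF _ H] by (simp add: p_def compose_def)
      ultimately show "\<rho> \<in> F" unfolding F_def using fixed_iff by blast
    next
      fix \<rho> assume "\<rho> \<in> F"
      then have \<rho>: "\<rho> \<in> characters G" "\<forall>h\<in>H. \<rho> h = 1" unfolding F_def using fixed_iff by auto
      have "\<rho> x = \<rho> y" if xy: "x \<in> carrier G" "y \<in> carrier G" "H #> x = H #> y" for x y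
      proof -
        have "x \<in> H #> y" using rcos_self[OF xy(1) H] xy(3) by simp
        then obtain h where h: "h \<in> H" "x = h \<otimes> y" by (auto simp: r_coset_def)
        then show ?thesis using \<rho> character_mult[OF \<rho>(1) H.mem_carrier[OF h(1)] xy(2)] by simp
      qed
      moreover have "\<rho> \<in> hom G circle_group" using \<rho> by (simp add: characters_def)
      ultimately obtain g where g: "g \<in> hom (G Mod H) circle_group" "\<And>x. x \<in> carrier G \<Longrightarrow> g (H #> x) = \<rho> x"
        using FactGroup_universal[OF _ H.normal_axioms] by metis
      have "restrict g (carrier (G Mod H)) \<in> characters (G Mod H)"
        using g(1) Q.m_closed by (auto simp: characters_def hom_def simp del: mult_FactGroup)
      moreover have "\<rho> = p (restrict g (carrier (G Mod H)))"
        using g(2) \<rho>(1) hom_in_carrier[OF \<pi>]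
        by (auto simp: p_def compose_def characters_def extensional_def fun_eq_iff)
      ultimately show "\<rho> \<in> p ` characters (G Mod H)" by blast
    qed
  qed
  then show "finite F" "card F = card (carrier G // twisted_conj G \<beta>)"
    using Q.card_characters Q.finite_characters fin bij_betw_finite bij_betw_same_card
    by (metis classes, metis classes order_def)
qed

end

section \<open>Almost superadditive sequences\<close>

lemma tendsto_affine_ratio: "(\<lambda>n. r * (real n + k) / real n) \<longlonglongrightarrow> (r::real)"
proof -
  have "(\<lambda>n. r + r * k * (1 / real n)) \<longlonglongrightarrow> r + r * k * 0"
    by (intro tendsto_intros lim_1_over_n)
  moreover have "eventually (\<lambda>n. r + r * k * (1 / real n) = r * (real n + k) / real n) sequentially"
    using eventually_gt_at_top[of 0] by eventually_elim (simp add: field_simps)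
  ultimately show ?thesis by (simp add: tendsto_cong)
qed

text \<open>Concatenating \<open>q\<close> blocks of length \<open>m\<close>, each followed by a gap of length \<open>K\<close>.\<close>

lemma almost_superadditive_ge_multiple:
  fixes a :: "nat \<Rightarrow> real"
  assumes nonneg: "\<And>n. 0 \<le> a n"
    and super: "\<And>m n. 1 \<le> m \<Longrightarrow> 1 \<le> n \<Longrightarrow> a m + a n \<le> a (m + n + K)"
    and m: "1 \<le> m" and n: "1 \<le> n"
  shows "(real n / real (m + K) - 1) * a m \<le> a n"
proof -
  define M where "M = m + K"
  have mult: "real q * a m \<le> a (q * M + r)" if "1 \<le> r" for q r
  proof (induction q)
    case (Suc q)
    have "a (q * M + r) + a m \<le> a ((q * M + r) + m + K)" using super m that by simp
    also have "(q * M + r) + m + K = Suc q * M + r" by (simp add: M_def)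
    finally show ?case using Suc by (simp add: algebra_simps)
  qed (use nonneg in simp)
  \<comment> \<open>Dividing \<open>n - 1\<close> instead of \<open>n\<close> leaves a remainder block of positive length.\<close>
  define q where "q = (n - 1) div M"
  have M: "M > 0" using m by (simp add: M_def)
  have n_eq: "n = q * M + ((n - 1) mod M + 1)" using n by (simp add: q_def)
  have "(n - 1) mod M + 1 \<le> M" using mod_less_divisor[OF M, of "n - 1"] by linarith
  then have "n \<le> q * M + M" using n_eq by linarith
  then have "real n \<le> real q * real M + real M" by (metis of_nat_add of_nat_le_iff of_nat_mult)
  then have "real n / real M - 1 \<le> real q" using M by (simp add: field_simps)
  then have "(real n / real M - 1) * a m \<le> real q * a m" using nonneg by (intro mult_right_mono)
  also have "\<dots> \<le> a n" using mult[of "(n - 1) mod M + 1" q] n_eq by simp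
  finally show ?thesis by (simp add: M_def)
qed

text \<open>Fekete's lemma with gaps. The bound by the limit is kept as well, since it controls shifted
  sequences. The limit may be infinite.\<close>

lemma almost_superadditive_convergent:
  fixes a :: "nat \<Rightarrow> real"
  assumes nonneg: "\<And>n. 0 \<le> a n"
    and super: "\<And>m n. 1 \<le> m \<Longrightarrow> 1 \<le> n \<Longrightarrow> a m + a n \<le> a (m + n + K)"
  obtains L :: ereal where "(\<lambda>n. ereal (a n / real n)) \<longlonglongrightarrow> L"
    "\<And>m. 1 \<le> m \<Longrightarrow> ereal (a m / real (m + K)) \<le> L"
proof
  define L where "L = liminf (\<lambda>n. ereal (a n / real n))"
  show bound: "ereal (a m / real (m + K)) \<le> L" if m: "1 \<le> m" for m
  proof -
    have "(\<lambda>n. a m / real (m + K) - a m * (1 / real n)) \<longlonglongrightarrow> a m / real (m + K) - a m * 0"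
      by (intro tendsto_intros lim_1_over_n)
    then have lim: "(\<lambda>n. ereal (a m / real (m + K) - a m * (1 / real n))) \<longlonglongrightarrow> ereal (a m / real (m + K))"
      by (simp add: tendsto_ereal)
    have "eventually (\<lambda>n. ereal (a m / real (m + K) - a m * (1 / real n)) \<le> ereal (a n / real n)) sequentially"
      using eventually_ge_at_top[of 1]
    proof eventually_elim
      case (elim n)
      have "a m / real (m + K) - a m * (1 / real n) = (real n / real (m + K) - 1) * a m / real n"
        using elim m by (simp add: field_simps)
      also have "\<dots> \<le> a n / real n"
        by (intro divide_right_mono almost_superadditive_ge_multiple[OF nonneg super m]) (use elim in auto)
      finally show ?case by simp
    qed
    then have "liminf (\<lambda>n. ereal (a m / real (m + K) - a m * (1 / real n))) \<le> L"
      unfolding L_def by (rule Liminf_mono)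
    then show ?thesis using lim_imp_Liminf[OF _ lim] by simp
  qed
  have "limsup (\<lambda>n. ereal (a n / real n)) \<le> L"
  proof (cases L)
    case (real r)
    have "eventually (\<lambda>n. ereal (a n / real n) \<le> ereal (r * (real n + K) / real n)) sequentially"
      using eventually_ge_at_top[of 1]
    proof eventually_elim
      case (elim n)
      have "a n \<le> r * (real n + K)" using bound[OF elim] elim real by (simp add: pos_divide_le_eq)
      then show ?case by (simp add: divide_right_mono)
    qed
    then have "limsup (\<lambda>n. ereal (a n / real n)) \<le> limsup (\<lambda>n. ereal (r * (real n + K) / real n))"
      by (rule Limsup_mono)
    also have "\<dots> = L"
      using lim_imp_Limsup[OF _ tendsto_ereal[OF tendsto_affine_ratio[of r K]]] real by simp
    finally show ?thesis .
  next
    case MInf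
    then show ?thesis using bound[of 1] by simp
  qed simp
  then show "(\<lambda>n. ereal (a n / real n)) \<longlonglongrightarrow> L"
    using Liminf_le_Limsup[of sequentially "\<lambda>n. ereal (a n / real n)"]
    by (intro Liminf_eq_Limsup) (auto simp: L_def)
qed

section \<open>Periodic points and entropy\<close>

text \<open>A two-sided orbit of a periodic point is seen within one period, which turns expansiveness into a
  separation of periodic points in bounded time.\<close>

lemma int_iterate_periodic:
  assumes bij: "bij_betw f X X" and x: "x \<in> X" "(f ^^ n) x = x" and n: "1 \<le> n"
  shows "int_iterate X f k x = (f ^^ nat (k mod int n)) x"
proof -
  have iter: "(f ^^ j) x \<in> X" for j
    by (induction j) (use x bij in \<open>auto simp: bij_betw_def\<close>)
  have inv: "(inv_into X f ^^ j) ((f ^^ j) y) = y" if "\<And>i. (f ^^ i) y \<in> X" for j y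
  proof (induction j)
    case (Suc j)
    have "(inv_into X f ^^ Suc j) ((f ^^ Suc j) y) = (inv_into X f ^^ j) (inv_into X f (f ((f ^^ j) y)))"
      by (simp add: funpow_swap1)
    also have "\<dots> = y"
      using Suc that[of j] bij by (simp add: bij_betw_def inv_into_f_f)
    finally show ?case .
  qed simp
  have period: "(f ^^ (j * n)) x = x" for j
    using funpow_mod_eq[OF x(2), of "j * n"] by simp
  have pos: "(f ^^ j) x = (f ^^ nat (int j mod int n)) x" for j
    using funpow_mod_eq[OF x(2), of j] by (simp flip: zmod_int)
  show ?thesis
  proof (cases "k \<ge> 0")
    case True
    then show ?thesis using pos[of "nat k"] by (simp add: int_iterate_def)
  next
    case False
    define j where "j = nat (- k)"
    define e where "e = j * n - j"
    have e: "j + e = j * n" "int e = k + int j * int n"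
      using n False by (auto simp: e_def j_def of_nat_diff)
    have "(inv_into X f ^^ j) x = (inv_into X f ^^ j) ((f ^^ j) ((f ^^ e) x))"
      by (simp only: period e(1) flip: funpow_add[THEN fun_cong, unfolded o_apply])
    also have "\<dots> = (f ^^ e) x"
    proof (rule inv)
      fix i show "(f ^^ i) ((f ^^ e) x) \<in> X" using iter[of "i + e"] by (simp add: funpow_add)
    qed
    also have "\<dots> = (f ^^ nat (k mod int n)) x" using pos[of e] e(2) by simp
    finally show ?thesis using False by (simp add: int_iterate_def j_def)
  qed
qed

text \<open>One segment suffices to compare separated sets with periodic points; two segments yield both
  almost superadditivity and the constancy of invariant functions.\<close>

lemma specification_one:
  assumes "specification_property X d f" "\<epsilon> > 0"
  shows "\<exists>D. \<forall>n\<ge>1. \<forall>x\<in>X. \<exists>z\<in>X. (f ^^ (n + D)) z = z \<and> (\<forall>k<n. d ((f ^^ k) z) ((f ^^ k) x) < \<epsilon>)"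
proof -
  obtain D where D: "\<forall>(r::nat) x l. (\<forall>s\<in>{1..r}. x s \<in> X \<and> l s \<ge> 1) \<longrightarrow>
     (\<exists>z\<in>X. (f ^^ spec_time l D (r + 1)) z = z \<and>
           (\<forall>s\<in>{1..r}. \<forall>k<l s. d ((f ^^ (spec_time l D s + k)) z) ((f ^^ k) (x s)) < \<epsilon>))"
    using assms(1)[unfolded specification_property_def, THEN spec, THEN mp, OF assms(2)]
    by (elim exE conjE) (rule that)
  have traced: "\<exists>z\<in>X. (f ^^ (n + D)) z = z \<and> (\<forall>k<n. d ((f ^^ k) z) ((f ^^ k) x) < \<epsilon>)"
    if nx: "1 \<le> n" "x \<in> X" for n x
    using nx D[THEN spec, of 1, THEN spec, of "\<lambda>_. x", THEN spec, of "\<lambda>_. n"] by (simp add: spec_time_def)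
  show ?thesis by (intro exI[of _ D] allI ballI impI traced)
qed

lemma specification_two:
  assumes "specification_property X d f" "\<epsilon> > 0"
  shows "\<exists>D. \<forall>m\<ge>1. \<forall>n\<ge>1. \<forall>x\<in>X. \<forall>y\<in>X. \<exists>z\<in>X. (f ^^ (m + n + 2 * D)) z = z \<and>
    (\<forall>k<m. d ((f ^^ k) z) ((f ^^ k) x) < \<epsilon>) \<and> (\<forall>k<n. d ((f ^^ (m + D + k)) z) ((f ^^ k) y) < \<epsilon>)"
proof -
  obtain D where D: "\<forall>(r::nat) x l. (\<forall>s\<in>{1..r}. x s \<in> X \<and> l s \<ge> 1) \<longrightarrow>
     (\<exists>z\<in>X. (f ^^ spec_time l D (r + 1)) z = z \<and>
           (\<forall>s\<in>{1..r}. \<forall>k<l s. d ((f ^^ (spec_time l D s + k)) z) ((f ^^ k) (x s)) < \<epsilon>))"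
    using assms(1)[unfolded specification_property_def, THEN spec, THEN mp, OF assms(2)]
    by (elim exE conjE) (rule that)
  have traced: "\<exists>z\<in>X. (f ^^ (m + n + 2 * D)) z = z \<and>
    (\<forall>k<m. d ((f ^^ k) z) ((f ^^ k) x) < \<epsilon>) \<and> (\<forall>k<n. d ((f ^^ (m + D + k)) z) ((f ^^ k) y) < \<epsilon>)"
    if mn: "1 \<le> m" "1 \<le> n" and xy: "x \<in> X" "y \<in> X" for m n x y
  proof -
    define p where "p s = (if s = Suc 0 then x else y)" for s
    define l where "l s = (if s = Suc 0 then m else n)" for s
    have t: "spec_time l D 1 = 0" "spec_time l D 2 = m + D" "spec_time l D (2 + 1) = m + n + 2 * D"
      by (simp_all add: spec_time_def l_def numeral_2_eq_2)
    obtain z where z: "z \<in> X" "(f ^^ spec_time l D (2 + 1)) z = z"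
      "\<forall>s\<in>{1..2}. \<forall>k<l s. d ((f ^^ (spec_time l D s + k)) z) ((f ^^ k) (p s)) < \<epsilon>"
      using D[THEN spec, of 2, THEN spec, of p, THEN spec, of l] mn xy by (auto simp: p_def l_def)
    have "\<forall>k<m. d ((f ^^ k) z) ((f ^^ k) x) < \<epsilon>"
      using bspec[OF z(3), of 1] t by (simp add: p_def l_def)
    moreover have "\<forall>k<n. d ((f ^^ (m + D + k)) z) ((f ^^ k) y) < \<epsilon>"
      using bspec[OF z(3), of 2] t by (simp add: p_def l_def)
    ultimately show ?thesis using z(1,2) t(3) by auto
  qed
  show ?thesis by (intro exI[of _ D] allI ballI impI traced)
qed

text \<open>Bowen's argument. By expansiveness distinct points of period \<open>n\<close> are separated at scale \<open>\<epsilon>\<close> within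
  time \<open>n\<close>. By specification each point of a set separated at a smaller scale \<open>e\<close> is traced for time
  \<open>n\<close> by a point of period \<open>n + E\<close>, and different points have different tracers. So the separation
  numbers lie between \<open>card (P n)\<close> and \<open>card (P (n + E))\<close> for every \<open>e \<le> \<epsilon>\<close>; in particular they are
  finite, and their growth does not depend on \<open>e\<close>. Tracing two periodic orbits at once shows that
  \<open>ln (card (P n))\<close> is almost superadditive, so its growth rate is a limit.\<close>

lemma (in Metric_space) entropy_eq_periodic_growth:
  fixes f :: "'a \<Rightarrow> 'a"
  defines "P n \<equiv> {x \<in> M. (f ^^ n) x = x}"
  assumes expansive: "expansive_homeomorphism M d f"
    and spec: "specification_property M d f"
    and fin: "\<And>n. 1 \<le> n \<Longrightarrow> finite (P n)"
    and fixed: "x0 \<in> M" "f x0 = x0"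
  shows "(\<lambda>n. ereal (ln (real (card (P n))) / real n)) \<longlonglongrightarrow> topological_entropy M d f"
proof -
  have bij: "bij_betw f M M"
    using expansive homeomorphic_imp_surjective_map[of mtopology mtopology f]
      homeomorphic_imp_injective_map[of mtopology mtopology f]
    by (simp add: expansive_homeomorphism_def bij_betw_def)
  have iter: "(f ^^ j) x \<in> M" if "x \<in> M" for x j
    using that by (induction j) (use bij in \<open>auto simp: bij_betw_def\<close>)
  obtain \<epsilon> where \<epsilon>: "\<epsilon> > 0" "\<And>x y. x \<in> M \<Longrightarrow> y \<in> M \<Longrightarrow> x \<noteq> y \<Longrightarrow>
      \<exists>k::int. d (int_iterate M f k x) (int_iterate M f k y) > \<epsilon>"
    using expansive unfolding expansive_homeomorphism_def by blast
  have sep: "\<exists>i<n. d ((f ^^ i) x) ((f ^^ i) y) > \<epsilon>"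
    if nxy: "1 \<le> n" "x \<in> P n" "y \<in> P n" "x \<noteq> y" for n x y
  proof -
    obtain k :: int where "d (int_iterate M f k x) (int_iterate M f k y) > \<epsilon>"
      using \<epsilon>(2)[of x y] nxy by (auto simp: P_def)
    then have "d ((f ^^ nat (k mod int n)) x) ((f ^^ nat (k mod int n)) y) > \<epsilon>"
      using nxy int_iterate_periodic[OF bij, of x n k] int_iterate_periodic[OF bij, of y n k] by (simp add: P_def)
    moreover have "nat (k mod int n) < n" using nxy(1) by (simp add: nat_less_iff)
    ultimately show ?thesis by blast
  qed
  have sep_eq: "x = y" if xy: "1 \<le> n" "x \<in> P n" "y \<in> P n"
    and close: "\<And>i. i < n \<Longrightarrow> d ((f ^^ i) x) ((f ^^ i) y) < \<epsilon>" for n x y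
    using sep[OF xy] close less_asym by blast
  have near: "d u v < e" if "d w u < e / 2" "d w v < e / 2" "u \<in> M" "v \<in> M" "w \<in> M" for u v w e
    using triangle[of u w v] that commute[of u w] by auto
  have P_fixed: "x0 \<in> P n" for n
    unfolding P_def using fixed by (induction n) auto
  have card_pos: "card (P n) \<ge> 1" if "1 \<le> n" for n
    using P_fixed[of n] fin[OF that] by (metis One_nat_def Suc_leI card_gt_0_iff empty_iff)
  define a where "a n = (if n = 0 then 0 else ln (real (card (P n))))" for n
  have a_nonneg: "0 \<le> a n" for n using card_pos[of n] by (simp add: a_def)
  obtain D where D: "\<forall>m\<ge>1. \<forall>n\<ge>1. \<forall>x\<in>M. \<forall>y\<in>M. \<exists>z\<in>M. (f ^^ (m + n + 2 * D)) z = z \<and>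
    (\<forall>k<m. d ((f ^^ k) z) ((f ^^ k) x) < \<epsilon> / 2) \<and> (\<forall>k<n. d ((f ^^ (m + D + k)) z) ((f ^^ k) y) < \<epsilon> / 2)"
    using specification_two[OF spec half_gt_zero[OF \<epsilon>(1)]] by (elim exE) (rule that)
  have super: "a m + a n \<le> a (m + n + 2 * D)" if mn: "1 \<le> m" "1 \<le> n" for m n
  proof -
    have "\<forall>p\<in>P m \<times> P n. \<exists>z. z \<in> P (m + n + 2 * D) \<and>
        (\<forall>k<m. d ((f ^^ k) z) ((f ^^ k) (fst p)) < \<epsilon> / 2) \<and>
        (\<forall>k<n. d ((f ^^ (m + D + k)) z) ((f ^^ k) (snd p)) < \<epsilon> / 2)"
    proof
      fix p assume "p \<in> P m \<times> P n"
      then have "fst p \<in> M" "snd p \<in> M" by (auto simp: P_def)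
      from D[rule_format, OF mn this] show "\<exists>z. z \<in> P (m + n + 2 * D) \<and>
        (\<forall>k<m. d ((f ^^ k) z) ((f ^^ k) (fst p)) < \<epsilon> / 2) \<and>
        (\<forall>k<n. d ((f ^^ (m + D + k)) z) ((f ^^ k) (snd p)) < \<epsilon> / 2)"
        unfolding P_def by blast
    qed
    from bchoice[OF this] obtain g where g': "\<forall>p\<in>P m \<times> P n. g p \<in> P (m + n + 2 * D) \<and>
        (\<forall>k<m. d ((f ^^ k) (g p)) ((f ^^ k) (fst p)) < \<epsilon> / 2) \<and>
        (\<forall>k<n. d ((f ^^ (m + D + k)) (g p)) ((f ^^ k) (snd p)) < \<epsilon> / 2)" by (elim exE) (rule that)
    note g = bspec[OF g']
    note g1 = conjunct1[OF g] and g2 = conjunct1[OF conjunct2[OF g]] and g3 = conjunct2[OF conjunct2[OF g]]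
    have "inj_on g (P m \<times> P n)"
    proof (rule inj_onI)
      fix p q assume p: "p \<in> P m \<times> P n" and q: "q \<in> P m \<times> P n" and eq: "g p = g q"
      have M: "fst p \<in> M" "fst q \<in> M" "snd p \<in> M" "snd q \<in> M" "g p \<in> M"
        using p q g1[OF p] by (auto simp: P_def)
      have fst: "d ((f ^^ k) (fst p)) ((f ^^ k) (fst q)) < \<epsilon>" if "k < m" for k
        by (rule near[OF g2[rule_format, OF p that] _ iter[OF M(1)] iter[OF M(2)] iter[OF M(5)]])
          (use g2[rule_format, OF q that] eq in simp)
      have snd: "d ((f ^^ k) (snd p)) ((f ^^ k) (snd q)) < \<epsilon>" if "k < n" for k
        by (rule near[OF g3[rule_format, OF p that] _ iter[OF M(3)] iter[OF M(4)] iter[OF M(5)]])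
          (use g3[rule_format, OF q that] eq in simp)
      have "fst p = fst q" by (rule sep_eq[OF mn(1) _ _ fst]) (use p q in auto)
      moreover have "snd p = snd q" by (rule sep_eq[OF mn(2) _ _ snd]) (use p q in auto)
      ultimately show "p = q" by (simp add: prod_eq_iff)
    qed
    then have "card (P m \<times> P n) \<le> card (P (m + n + 2 * D))"
      using g1 fin mn by (intro card_inj_on_le) auto
    then have "real (card (P m)) * real (card (P n)) \<le> real (card (P (m + n + 2 * D)))"
      unfolding card_cartesian_product by (metis of_nat_le_iff of_nat_mult)
    moreover have "0 < real (card (P m)) * real (card (P n))"
      using card_pos[OF mn(1)] card_pos[OF mn(2)] by simp
    ultimately have "ln (real (card (P m)) * real (card (P n))) \<le> ln (real (card (P (m + n + 2 * D))))"
      by (rule ln_mono)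
    then show ?thesis
      using mn card_pos[OF mn(1)] card_pos[OF mn(2)] by (simp add: a_def ln_mult_pos)
  qed
  obtain L where L: "(\<lambda>n. ereal (a n / real n)) \<longlonglongrightarrow> L"
    and L_bound: "\<And>m. 1 \<le> m \<Longrightarrow> ereal (a m / real (m + 2 * D)) \<le> L"
    using almost_superadditive_convergent[OF a_nonneg super] by metis
  have limsup_sep: "limsup (\<lambda>n. ereal (ln (real (sep_number M d f n e)) / real n)) = L"
    if e: "0 < e" "e \<le> \<epsilon>" for e
  proof -
    obtain E where E: "\<forall>n\<ge>1. \<forall>x\<in>M. \<exists>z\<in>M. (f ^^ (n + E)) z = z \<and> (\<forall>k<n. d ((f ^^ k) z) ((f ^^ k) x) < e / 2)"
      using specification_one[OF spec half_gt_zero[OF e(1)]] by (elim exE) (rule that)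
    have sep_le: "card S \<le> card (P (n + E))" if n: "1 \<le> n" and S: "finite S" "separated_set M d f n e S" for n S
    proof -
      have SM: "x \<in> M" if "x \<in> S" for x using that S(2) by (auto simp: separated_set_def)
      have "\<forall>x\<in>S. \<exists>z. z \<in> P (n + E) \<and> (\<forall>k<n. d ((f ^^ k) z) ((f ^^ k) x) < e / 2)"
        using E[rule_format, OF n SM] unfolding P_def by blast
      from bchoice[OF this] obtain g where
        g: "\<forall>x\<in>S. g x \<in> P (n + E) \<and> (\<forall>k<n. d ((f ^^ k) (g x)) ((f ^^ k) x) < e / 2)"
        by (elim exE) (rule that)
      note g1 = conjunct1[OF bspec[OF g]] and g2 = conjunct2[OF bspec[OF g]]
      have "inj_on g S"
      proof (rule inj_onI)
        fix x y assume x: "x \<in> S" and y: "y \<in> S" and eq: "g x = g y"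
        have "d ((f ^^ k) x) ((f ^^ k) y) < e" if "k < n" for k
          by (rule near[OF g2[rule_format, OF x that] _ iter[OF SM[OF x]] iter[OF SM[OF y]] iter])
            (use g2[rule_format, OF y that] g1[OF x] eq in \<open>simp_all add: P_def\<close>)
        then show "x = y" using S(2) x y unfolding separated_set_def by (meson not_le)
      qed
      then show ?thesis using g1 fin[of "n + E"] n by (intro card_inj_on_le) auto
    qed
    define C where "C n = card ` {S. finite S \<and> separated_set M d f n e S}" for n
    have C_bound: "c \<le> card (P (n + E))" if "1 \<le> n" "c \<in> C n" for n c
      using that sep_le by (auto simp: C_def)
    have C_fin: "finite (C n)" if "1 \<le> n" for n
      by (rule finite_subset[of _ "{..card (P (n + E))}"]) (simp_all add: subset_iff C_bound[OF that])
    have P_C: "card (P n) \<in> C n" if n: "1 \<le> n" for n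
      unfolding C_def
    proof (intro imageI CollectI conjI fin[OF n])
      show "separated_set M d f n e (P n)"
        unfolding separated_set_def
      proof (intro conjI ballI impI)
        fix x y assume xy: "x \<in> P n" "y \<in> P n" "x \<noteq> y"
        obtain i where "i < n" "d ((f ^^ i) x) ((f ^^ i) y) > \<epsilon>" using sep[OF n xy] by blast
        then show "\<exists>i<n. e \<le> d ((f ^^ i) x) ((f ^^ i) y)" using e(2) by (intro exI[of _ i]) auto
      qed (auto simp: P_def)
    qed
    have lower: "card (P n) \<le> sep_number M d f n e" if "1 \<le> n" for n
      using Max_ge[OF C_fin P_C] that by (simp add: sep_number_def C_def)
    have upper: "sep_number M d f n e \<le> card (P (n + E))" if "1 \<le> n" for n
    proof -
      have "C n \<noteq> {}" using P_C[OF that] by blast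
      then have "Max (C n) \<in> C n" by (rule Max_in[OF C_fin[OF that]])
      then show ?thesis using C_bound[OF that] unfolding sep_number_def C_def by blast
    qed
    let ?s = "\<lambda>n. ereal (ln (real (sep_number M d f n e)) / real n)"
    have "eventually (\<lambda>n. ereal (a n / real n) \<le> ?s n) sequentially"
      using eventually_ge_at_top[of 1]
    proof eventually_elim
      case (elim n)
      have "ln (real (card (P n))) \<le> ln (real (sep_number M d f n e))"
        using lower[OF elim] card_pos[OF elim] by (subst ln_le_cancel_iff) auto
      then show ?case using elim by (simp add: a_def divide_right_mono)
    qed
    then have "limsup (\<lambda>n. ereal (a n / real n)) \<le> limsup ?s" by (rule Limsup_mono)
    then have "L \<le> limsup ?s" using lim_imp_Limsup[OF _ L] by simp
    moreover have "limsup ?s \<le> L"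
    proof (cases L)
      case (real r)
      have "eventually (\<lambda>n. ?s n \<le> ereal (r * (real n + (E + 2 * D)) / real n)) sequentially"
        using eventually_ge_at_top[of 1]
      proof eventually_elim
        case (elim n)
        have "ln (real (sep_number M d f n e)) \<le> a (n + E)"
          using lower[OF elim] upper[OF elim] card_pos[OF elim] elim by (simp add: a_def)
        also have "\<dots> \<le> r * (real n + (E + 2 * D))"
          using L_bound[of "n + E"] elim real by (simp add: pos_divide_le_eq add.assoc)
        finally show ?case by (simp add: divide_right_mono)
      qed
      then have "limsup ?s \<le> limsup (\<lambda>n. ereal (r * (real n + (E + 2 * D)) / real n))"
        by (rule Limsup_mono)
      also have "\<dots> = L"
        using lim_imp_Limsup[OF _ tendsto_ereal[OF tendsto_affine_ratio[of r "real (E + 2 * D)"]]] real by simp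
      finally show ?thesis .
    next
      case MInf
      then show ?thesis using L_bound[of 1] by simp
    qed simp
    ultimately show ?thesis by (rule order_antisym[rotated])
  qed
  have "eventually (\<lambda>e. e \<in> {0<..<\<epsilon>}) (at_right 0)"
    using eventually_at_right_field \<epsilon>(1) by auto
  then have "eventually (\<lambda>e. L = limsup (\<lambda>n. ereal (ln (real (sep_number M d f n e)) / real n))) (at_right 0)"
    by eventually_elim (use limsup_sep in auto)
  then have "((\<lambda>e. limsup (\<lambda>n. ereal (ln (real (sep_number M d f n e)) / real n))) \<longlongrightarrow> L) (at_right 0)"
    by (rule Lim_transform_eventually[OF tendsto_const])
  then have "topological_entropy M d f = L"
    unfolding topological_entropy_def by (intro tendsto_Lim) auto
  moreover have "eventually (\<lambda>n. ereal (a n / real n) = ereal (ln (real (card (P n))) / real n)) sequentially"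
    using eventually_gt_at_top[of 0] by eventually_elim (simp add: a_def)
  ultimately show ?thesis using Lim_transform_eventually[OF L] by simp
qed

section \<open>Specification on the dual forces fixed-point-freeness\<close>

lemma funpow_hom: "\<alpha> \<in> hom G G \<Longrightarrow> \<alpha> ^^ n \<in> hom G G"
proof (induction n)
  case (Suc n)
  then show ?case by (auto simp: hom_def Pi_iff)
qed (simp add: hom_def)

lemma dual_map_funpow:
  assumes "\<rho> \<in> extensional (carrier A)" "\<And>x. x \<in> carrier A \<Longrightarrow> \<alpha> x \<in> carrier A"
  shows "(dual_map A \<alpha> ^^ n) \<rho> = restrict (\<rho> \<circ> (\<alpha> ^^ n)) (carrier A)"
proof (induction n)
  case (Suc n)
  show ?case
  proof (rule extensionalityI[of _ "carrier A"])
    fix x assume x: "x \<in> carrier A"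
    have "(dual_map A \<alpha> ^^ Suc n) \<rho> x = ((dual_map A \<alpha> ^^ n) \<rho>) (\<alpha> x)"
      using x by (simp add: dual_map_def)
    also have "\<dots> = \<rho> ((\<alpha> ^^ n) (\<alpha> x))" using assms(2)[OF x] Suc by simp
    finally show "(dual_map A \<alpha> ^^ Suc n) \<rho> x = restrict (\<rho> \<circ> (\<alpha> ^^ Suc n)) (carrier A) x"
      using x by (simp add: funpow_swap1)
  qed (simp_all only: funpow.simps o_apply dual_map_def restrict_extensional)
qed (use assms(1) in \<open>simp add: extensional_restrict\<close>)

lemma evaluation_continuous:
  assumes "Metric_space (characters A) d" "Metric_space.mtopology (characters A) d = dual_topology A"
    and a: "a \<in> carrier A" and \<rho>: "\<rho> \<in> characters A" and "e > 0"
  shows "\<exists>\<delta>>0. \<forall>\<sigma>\<in>characters A. d \<rho> \<sigma> < \<delta> \<longrightarrow> norm (\<sigma> a - \<rho> a) < e"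
proof -
  interpret M: Metric_space "characters A" d by fact
  let ?S = "top_of_set (sphere 0 1 :: complex set)"
  have "continuous_map (dual_topology A) ?S (\<lambda>\<rho>. \<rho> a)"
    unfolding dual_topology_def compact_open_discrete
    using a by (intro continuous_map_from_subtopology continuous_map_product_projection)
  then have cont: "continuous_map M.mtopology ?S (\<lambda>\<rho>. \<rho> a)" by (simp add: assms(2))
  have op_ball: "openin ?S (sphere 0 1 \<inter> ball (\<rho> a) e)" by (simp add: openin_open_Int)
  have op: "openin M.mtopology {\<sigma> \<in> characters A. \<sigma> a \<in> sphere 0 1 \<inter> ball (\<rho> a) e}"
    using openin_continuous_map_preimage[OF cont op_ball] by (simp only: M.topspace_mtopology)
  have "\<rho> a \<in> sphere 0 1" using \<rho> a by (auto simp: characters_def hom_def)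
  then have "\<rho> \<in> {\<sigma> \<in> characters A. \<sigma> a \<in> sphere 0 1 \<inter> ball (\<rho> a) e}" using \<rho> assms(5) by simp
  then obtain \<delta> where \<delta>: "\<delta> > 0" "M.mball \<rho> \<delta> \<subseteq> {\<sigma> \<in> characters A. \<sigma> a \<in> sphere 0 1 \<inter> ball (\<rho> a) e}"
    using op unfolding M.openin_mtopology by blast
  have "norm (\<sigma> a - \<rho> a) < e" if \<sigma>: "\<sigma> \<in> characters A" "d \<rho> \<sigma> < \<delta>" for \<sigma>
  proof -
    have "\<sigma> \<in> M.mball \<rho> \<delta>" using \<sigma> \<rho> by simp
    then have "\<sigma> a \<in> ball (\<rho> a) e" using \<delta>(2) by blast
    then show ?thesis by (simp add: dist_norm norm_minus_commute)
  qed
  then show ?thesis using \<delta>(1) by blast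
qed

text \<open>Evaluation at \<open>a\<close> is a continuous function on the dual that is invariant under the \<open>n\<close>-th iterate of
  the dual map. An orbit that starts near the trivial character and is near \<open>\<rho>\<close> at a multiple of \<open>n\<close>
  forces its values at these two characters to be close, so all characters agree at \<open>a\<close> with the
  trivial one. As characters separate points, \<open>a\<close> is trivial.\<close>

lemma (in comm_group) periodic_element_trivial:
  assumes \<alpha>: "\<alpha> \<in> hom G G"
    and metric: "Metric_space (characters G) d" "Metric_space.mtopology (characters G) d = dual_topology G"
    and spec: "specification_property (characters G) d (dual_map G \<alpha>)"
    and a: "a \<in> carrier G" "(\<alpha> ^^ n) a = a" and n: "1 \<le> n"
  shows "a = \<one>"
proof (rule ccontr)
  assume "a \<noteq> \<one>"
  then obtain \<rho> where \<rho>: "\<rho> \<in> characters G" "\<rho> a \<noteq> 1" using characters_separate a(1) by blast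
  define \<tau> where "\<tau> = restrict (\<lambda>_. 1::complex) (carrier G)"
  have \<tau>: "\<tau> \<in> characters G" "\<tau> a = 1" using trivial_character a(1) by (simp_all add: \<tau>_def)
  interpret M: Metric_space "characters G" d by fact
  define e where "e = norm (\<rho> a - 1) / 2"
  have e: "e > 0" using \<rho>(2) by (simp add: e_def)
  obtain \<delta>1 where \<delta>1: "\<delta>1 > 0" "\<And>\<sigma>. \<sigma> \<in> characters G \<Longrightarrow> d \<tau> \<sigma> < \<delta>1 \<Longrightarrow> norm (\<sigma> a - \<tau> a) < e"
    using evaluation_continuous[OF metric a(1) \<tau>(1) e] by blast
  obtain \<delta>2 where \<delta>2: "\<delta>2 > 0" "\<And>\<sigma>. \<sigma> \<in> characters G \<Longrightarrow> d \<rho> \<sigma> < \<delta>2 \<Longrightarrow> norm (\<sigma> a - \<rho> a) < e"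
    using evaluation_continuous[OF metric a(1) \<rho>(1) e] by blast
  let ?f = "dual_map G \<alpha>"
  have \<alpha>c: "\<alpha> x \<in> carrier G" if "x \<in> carrier G" for x using hom_in_carrier[OF \<alpha> that] .
  have \<alpha>n: "(\<alpha> ^^ j) \<in> hom G G" for j using \<alpha> by (rule funpow_hom)
  have \<delta>: "min \<delta>1 \<delta>2 > 0" using \<delta>1(1) \<delta>2(1) by simp
  obtain D where D: "\<forall>k\<ge>1. \<forall>l\<ge>1. \<forall>x\<in>characters G. \<forall>y\<in>characters G. \<exists>z\<in>characters G. (?f ^^ (k + l + 2 * D)) z = z \<and>
    (\<forall>i<k. d ((?f ^^ i) z) ((?f ^^ i) x) < min \<delta>1 \<delta>2) \<and> (\<forall>i<l. d ((?f ^^ (k + D + i)) z) ((?f ^^ i) y) < min \<delta>1 \<delta>2)"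
    using specification_two[OF spec \<delta>] by (elim exE) (rule that)
  \<comment> \<open>The first segment is chosen so long that the second starts at time \<open>k + D\<close>, a multiple of \<open>n\<close>.\<close>
  define k where "k = n * (D + 1) - D"
  have "D + 1 \<le> n * (D + 1)" using mult_le_mono1[OF n, of "D + 1"] by simp
  then have k: "1 \<le> k" "k + D = n * (D + 1)" by (simp_all add: k_def)
  obtain z where z: "z \<in> characters G" "\<forall>i<k. d ((?f ^^ i) z) ((?f ^^ i) \<tau>) < min \<delta>1 \<delta>2"
    "\<forall>i<1. d ((?f ^^ (k + D + i)) z) ((?f ^^ i) \<rho>) < min \<delta>1 \<delta>2"
    using D[rule_format, OF k(1) order_refl \<tau>(1) \<rho>(1)] by blast
  define w where "w = (?f ^^ (k + D)) z"
  have w_eq: "w = restrict (z \<circ> (\<alpha> ^^ (k + D))) (carrier G)"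
    unfolding w_def using z(1) \<alpha>c by (intro dual_map_funpow) (auto simp: characters_def)
  have "w \<in> characters G"
    using z(1) \<alpha>n[of "k + D"] hom_in_carrier[OF \<alpha>n] unfolding w_eq by (auto simp: characters_def hom_def)
  have "(\<alpha> ^^ (n * (D + 1))) a = a"
    using funpow_mod_eq[OF a(2), of "n * (D + 1)"] by simp
  then have "w a = z a" using a(1) by (simp add: w_eq k(2))
  have "d \<tau> z < \<delta>1" using z(2)[rule_format, of 0] k(1) by (simp add: M.commute)
  then have 1: "norm (z a - 1) < e" using \<delta>1(2)[OF z(1)] \<tau>(2) by simp
  have "d \<rho> w < \<delta>2" using z(3)[rule_format, of 0] by (simp add: M.commute w_def)
  then have 2: "norm (z a - \<rho> a) < e" using \<delta>2(2)[OF \<open>w \<in> characters G\<close>] \<open>w a = z a\<close> by simp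
  have "norm (\<rho> a - 1) \<le> norm (z a - 1) + norm (z a - \<rho> a)"
    using norm_triangle_ineq4[of "z a - 1" "z a - \<rho> a"] by simp
  then show False using 1 2 by (simp add: e_def)
qed

section \<open>Reidemeister numbers of powers and entropy of the dual map\<close>

text \<open>Reidemeister numbers of the powers of \<open>\<alpha>\<close> are numbers of periodic points of the dual map.\<close>

lemma (in comm_group) reidemeister_entropy:
  assumes \<alpha>: "\<alpha> \<in> hom G G" and tame: "tame G \<alpha>"
    and metric: "Metric_space (characters G) d"
    and expansive: "expansive_homeomorphism (characters G) d (dual_map G \<alpha>)"
    and spec: "specification_property (characters G) d (dual_map G \<alpha>)"
  shows "\<exists>p. (\<forall>n\<ge>1. reidemeister G (\<alpha> ^^ n) = enat (p n) \<and> 1 \<le> p n) \<and>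
    (\<lambda>n. ereal (ln (real (p n)) / real n)) \<longlonglongrightarrow> topological_entropy (characters G) d (dual_map G \<alpha>)"
proof -
  interpret M: Metric_space "characters G" d by fact
  define P where "P n = {\<rho> \<in> characters G. (dual_map G \<alpha> ^^ n) \<rho> = \<rho>}" for n
  have \<alpha>c: "\<alpha> x \<in> carrier G" if "x \<in> carrier G" for x using hom_in_carrier[OF \<alpha> that] .
  have P: "P n = {\<rho> \<in> characters G. restrict (\<rho> \<circ> (\<alpha> ^^ n)) (carrier G) = \<rho>}" for n
    unfolding P_def using dual_map_funpow[of _ G \<alpha> n] \<alpha>c by (auto simp: characters_def)
  have fin: "finite (carrier G // twisted_conj G (\<alpha> ^^ n))" if "1 \<le> n" for n
    using tame that unfolding tame_def reidemeister_def by (auto simp: Let_def split: if_splits)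
  have P_fin: "finite (P n)" if "1 \<le> n" for n
    unfolding P using card_fixed_characters(1)[OF funpow_hom[OF \<alpha>] fin[OF that]] .
  have P_card: "card (P n) = card (carrier G // twisted_conj G (\<alpha> ^^ n))" if "1 \<le> n" for n
    unfolding P using card_fixed_characters(2)[OF funpow_hom[OF \<alpha>] fin[OF that]] .
  have R: "reidemeister G (\<alpha> ^^ n) = enat (card (P n))" if "1 \<le> n" for n
    using fin[OF that] P_card[OF that] by (simp add: reidemeister_def)
  define \<tau> where "\<tau> = restrict (\<lambda>_. 1::complex) (carrier G)"
  have \<tau>: "\<tau> \<in> characters G" using trivial_character by (simp add: \<tau>_def)
  have \<tau>_fixed: "dual_map G \<alpha> \<tau> = \<tau>" using \<alpha>c by (auto simp: \<tau>_def dual_map_def fun_eq_iff)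
  have "\<tau> \<in> P n" for n
    unfolding P_def using \<tau> \<tau>_fixed by (induction n) auto
  then have pos: "1 \<le> card (P n)" if "1 \<le> n" for n
    using P_fin[OF that] by (metis One_nat_def Suc_leI card_gt_0_iff empty_iff)
  have "(\<lambda>n. ereal (ln (real (card (P n))) / real n)) \<longlonglongrightarrow> topological_entropy (characters G) d (dual_map G \<alpha>)"
    unfolding P_def
    by (rule M.entropy_eq_periodic_growth[OF expansive spec _ \<tau> \<tau>_fixed]) (use P_fin in \<open>simp add: P_def\<close>)
  then show ?thesis using R pos by (intro exI[of _ "\<lambda>n. card (P n)"] conjI allI impI)
qed

section \<open>The growth rate of a product\<close>

lemma ereal_exp_tendsto:
  assumes "(\<lambda>n. ereal (u n)) \<longlonglongrightarrow> L" "0 \<le> L"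
  shows "(\<lambda>n. ereal (exp (u n))) \<longlonglongrightarrow> ereal_exp L"
proof (cases L)
  case (real r)
  then have "u \<longlonglongrightarrow> r" using assms(1) by simp
  then show ?thesis using real by (auto simp: ereal_exp_def intro: tendsto_exp)
next
  case PInf
  then have "filterlim u at_top sequentially" using assms(1) by (simp add: tendsto_PInfty_eq_at_top)
  then have "filterlim (\<lambda>n. exp (u n)) at_top sequentially" by (rule filterlim_compose[OF exp_at_top])
  then show ?thesis using PInf by (simp add: ereal_exp_def tendsto_PInfty_eq_at_top)
qed (use assms in simp)

text \<open>The rates \<open>h k\<close> may be infinite; they are nonnegative, so their sum causes no trouble.\<close>

lemma root_prod_tendsto:
  fixes p :: "'k \<Rightarrow> nat \<Rightarrow> nat" and h :: "'k \<Rightarrow> ereal"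
  assumes "finite K" "\<And>k n. k \<in> K \<Longrightarrow> 1 \<le> n \<Longrightarrow> 1 \<le> p k n"
    and lim: "\<And>k. k \<in> K \<Longrightarrow> (\<lambda>n. ereal (ln (real (p k n)) / real n)) \<longlonglongrightarrow> h k"
  shows "(\<lambda>n. ereal (root n (real (\<Prod>k\<in>K. p k n)))) \<longlonglongrightarrow> ereal_exp (\<Sum>k\<in>K. h k)"
proof -
  have pos: "0 \<le> ereal (ln (real (p k n)) / real n)" if "k \<in> K" for k n
    using assms(2)[OF that, of n] by (cases "n = 0") auto
  have h: "0 \<le> h k" if "k \<in> K" for k
    using LIMSEQ_le_const[OF lim[OF that], of 0] pos[OF that] by blast
  have "(\<lambda>n. \<Sum>k\<in>K. ereal (ln (real (p k n)) / real n)) \<longlonglongrightarrow> (\<Sum>k\<in>K. h k)"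
    using assms(1) h lim
  proof (induction K rule: finite_induct)
    case (insert k K)
    have "0 \<le> (\<Sum>k\<in>K. h k)" using insert.prems(1) by (intro sum_nonneg) simp
    then have "(\<lambda>n. ereal (ln (real (p k n)) / real n) + (\<Sum>k\<in>K. ereal (ln (real (p k n)) / real n)))
        \<longlonglongrightarrow> h k + (\<Sum>k\<in>K. h k)"
      using insert.prems(1)[of k] insert.prems insert.IH by (intro tendsto_add_ereal_nonneg) auto
    then show ?case using insert.hyps by simp
  qed (simp flip: zero_ereal_def)
  then have "(\<lambda>n. ereal (\<Sum>k\<in>K. ln (real (p k n)) / real n)) \<longlonglongrightarrow> (\<Sum>k\<in>K. h k)"
    by (simp add: sum_ereal)
  moreover have "0 \<le> (\<Sum>k\<in>K. h k)" using h by (rule sum_nonneg)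
  ultimately have "(\<lambda>n. ereal (exp (\<Sum>k\<in>K. ln (real (p k n)) / real n))) \<longlonglongrightarrow> ereal_exp (\<Sum>k\<in>K. h k)"
    by (rule ereal_exp_tendsto)
  moreover have "eventually (\<lambda>n. ereal (exp (\<Sum>k\<in>K. ln (real (p k n)) / real n)) = ereal (root n (real (\<Prod>k\<in>K. p k n)))) sequentially"
    using eventually_ge_at_top[of 1]
  proof eventually_elim
    case (elim n)
    have p_pos: "0 < real (p k n)" if "k \<in> K" for k using assms(2)[OF that elim] by simp
    have "root n (real (\<Prod>k\<in>K. p k n)) = exp (ln (\<Prod>k\<in>K. real (p k n)) / real n)"
      using elim p_pos by (simp add: root_powr_inverse powr_def prod_nonneg prod_zero_iff[OF assms(1)])
    also have "ln (\<Prod>k\<in>K. real (p k n)) = (\<Sum>k\<in>K. ln (real (p k n)))"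
      by (rule ln_prod[OF assms(1)]) (use p_pos in force)
    finally show ?case by (simp add: sum_divide_distrib)
  qed
  ultimately show ?thesis by (rule Lim_transform_eventually)
qed

section \<open>The Reidemeister number as a product over the isolated factors\<close>

context group
begin

lemma isolated_lcs_normal_restrict:
  assumes "1 \<le> k" shows "isolated_lcs G (Suc k) \<lhd> G\<lparr>carrier := isolated_lcs G k\<rparr>"
  using normal_restrict_supergroup[OF isolated_lcs_subgroup[OF assms] isolated_lcs_normal[of "Suc k"]]
    isolated_lcs_decreasing[OF assms] by simp

lemma ilcs_factor_comm_group:
  assumes k: "1 \<le> k" shows "comm_group (ilcs_factor G k)"
proof -
  let ?N = "isolated_lcs G" and ?Gk = "G\<lparr>carrier := isolated_lcs G k\<rparr>"
  interpret Nk: subgroup "?N k" G by (rule isolated_lcs_subgroup[OF k])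
  interpret N': normal "?N (Suc k)" ?Gk by (rule isolated_lcs_normal_restrict[OF k])
  interpret N: normal "?N (Suc k)" G by (rule isolated_lcs_normal) simp
  have coset: "?N (Suc k) #>\<^bsub>?Gk\<^esub> x = ?N (Suc k) #> x" for x by (simp add: r_coset_def)
  have ilcs: "ilcs_factor G k = ?Gk Mod ?N (Suc k)" by (simp add: ilcs_factor_def)
  show ?thesis
    unfolding ilcs
  proof (rule group.group_comm_groupI[OF N'.factorgroup_is_group])
    fix X Y assume "X \<in> carrier (?Gk Mod ?N (Suc k))" "Y \<in> carrier (?Gk Mod ?N (Suc k))"
    then obtain x y where xy: "x \<in> ?N k" "X = ?N (Suc k) #>\<^bsub>?Gk\<^esub> x" "y \<in> ?N k" "Y = ?N (Suc k) #>\<^bsub>?Gk\<^esub> y"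
      unfolding carrier_FactGroup by auto
    have xyG: "x \<in> carrier G" "y \<in> carrier G" using xy Nk.mem_carrier by blast+
    have "commutator G x y \<in> ?N (Suc k)" by (rule isolated_lcs_commutator[OF k xyG(1) xy(3)])
    moreover have "commutator G x y = x \<otimes> y \<otimes> inv (y \<otimes> x)"
      using xyG by (simp add: commutator_def inv_mult_group m_assoc)
    ultimately have "?N (Suc k) #> (x \<otimes> y) = ?N (Suc k) #> (y \<otimes> x)"
      using N.coset_eq_iff[of "x \<otimes> y" "y \<otimes> x"] xyG by simp
    then show "X \<otimes>\<^bsub>?Gk Mod ?N (Suc k)\<^esub> Y = Y \<otimes>\<^bsub>?Gk Mod ?N (Suc k)\<^esub> X"
      using group_hom.hom_mult[OF N'.group_hom_coset, of x y] group_hom.hom_mult[OF N'.group_hom_coset, of y x] xy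
      by (simp add: coset)
  qed
qed

lemma ilcs_factor_induced_hom:
  assumes \<phi>: "\<phi> \<in> hom G G" and \<phi>N: "\<And>k. 1 \<le> k \<Longrightarrow> \<phi> ` isolated_lcs G k = isolated_lcs G k" and k: "1 \<le> k"
  shows "induced_map \<phi> \<in> hom (ilcs_factor G k) (ilcs_factor G k)"
proof -
  let ?Gk = "G\<lparr>carrier := isolated_lcs G k\<rparr>"
  interpret Nk: subgroup "isolated_lcs G k" G by (rule isolated_lcs_subgroup[OF k])
  interpret N': normal "isolated_lcs G (Suc k)" ?Gk by (rule isolated_lcs_normal_restrict[OF k])
    have "\<phi> \<in> hom ?Gk ?Gk"
    proof (rule homI)
      show "\<phi> x \<in> carrier ?Gk" if "x \<in> carrier ?Gk" for x using that \<phi>N[OF k] by auto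
      show "\<phi> (x \<otimes>\<^bsub>?Gk\<^esub> y) = \<phi> x \<otimes>\<^bsub>?Gk\<^esub> \<phi> y" if "x \<in> carrier ?Gk" "y \<in> carrier ?Gk" for x y
        using that Nk.mem_carrier hom_mult[OF \<phi>] by simp
    qed
    then show "induced_map \<phi> \<in> hom (ilcs_factor G k) (ilcs_factor G k)"
      unfolding ilcs_factor_def using \<phi>N[of "Suc k"] by (simp add: N'.induced_map_hom)
qed

lemma reidemeister_isolated_lcs:
  assumes tf: "torsion_free G" "nilpotent_of_class G c"
    and \<psi>: "\<psi> \<in> hom G G" and \<psi>N: "\<And>k. 1 \<le> k \<Longrightarrow> \<psi> ` isolated_lcs G k = isolated_lcs G k"
    and fixed: "\<And>k C. 1 \<le> k \<Longrightarrow> k \<le> c \<Longrightarrow> C \<in> carrier (ilcs_factor G k) \<Longrightarrow> induced_map \<psi> C = C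
      \<Longrightarrow> C = \<one>\<^bsub>ilcs_factor G k\<^esub>"
    and fin: "\<And>k. 1 \<le> k \<Longrightarrow> k \<le> c \<Longrightarrow> reidemeister (ilcs_factor G k) (induced_map \<psi>) = enat (p k)"
  shows "reidemeister G \<psi> = enat (\<Prod>k=1..c. p k)"
proof -
  let ?N = "isolated_lcs G"
  have fixed': "g \<in> ?N (Suc k)" if k: "1 \<le> k" "k \<le> c" and g: "g \<in> ?N k"
    and eq: "?N (Suc k) #> \<psi> g = ?N (Suc k) #> g" for k g
  proof -
    interpret N: normal "?N (Suc k)" G by (rule isolated_lcs_normal) simp
    have gG: "g \<in> carrier G" using g isolated_lcs_subset by blast
    have "?N (Suc k) #> g \<in> carrier (ilcs_factor G k)"
      using g by (auto simp: ilcs_factor_def carrier_FactGroup r_coset_def)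
    moreover have "induced_map \<psi> (?N (Suc k) #> g) = ?N (Suc k) #> g"
      using N.induced_map_coset[OF \<psi> \<psi>N gG] eq by simp
    ultimately have "?N (Suc k) #> g = \<one>\<^bsub>ilcs_factor G k\<^esub>" by (rule fixed[OF k])
    then show ?thesis using N.coset_eq_one_iff[OF gG] by (simp add: ilcs_factor_def)
  qed
  have "reidemeister (G Mod ?N (Suc c)) (induced_map \<psi>) = enat (\<Prod>k=1..c. p k)"
    by (rule reidemeister_central_series[OF \<psi> isolated_lcs_1 isolated_lcs_normal \<psi>N isolated_lcs_decreasing
          isolated_lcs_commutator fixed' _ order_refl, THEN conjunct1])
      (use fin in \<open>simp_all add: ilcs_factor_def\<close>)
  then show ?thesis
    using reidemeister_mod_one[OF \<psi>] isolated_lcs_last[OF tf] by simp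
qed

end

section \<open>The growth rate of Reidemeister numbers\<close>

theorem theorem12:
  fixes G :: "('a, 'b) monoid_scheme"
    and \<phi> :: "'a \<Rightarrow> 'a"
    and c :: nat
    and d :: "nat \<Rightarrow> ('a set \<Rightarrow> complex) \<Rightarrow> ('a set \<Rightarrow> complex) \<Rightarrow> real"
  assumes "group G"
    and "finitely_generated G"
    and "torsion_free G"
    and "nilpotent_of_class G c"
    and "\<phi> \<in> iso G G"
    and metric: "\<And>k. 1 \<le> k \<Longrightarrow> k \<le> c \<Longrightarrow> Metric_space (characters (ilcs_factor G k)) (d k)"
    and compatible: "\<And>k. 1 \<le> k \<Longrightarrow> k \<le> c \<Longrightarrow>
      Metric_space.mtopology (characters (ilcs_factor G k)) (d k) = dual_topology (ilcs_factor G k)"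
    and "\<And>k. 1 \<le> k \<Longrightarrow> k \<le> c \<Longrightarrow> tame (ilcs_factor G k) (induced_map \<phi>)"
    and "\<And>k. 1 \<le> k \<Longrightarrow> k \<le> c \<Longrightarrow>
      expansive_homeomorphism (characters (ilcs_factor G k)) (d k)
        (dual_map (ilcs_factor G k) (induced_map \<phi>))"
    and "\<And>k. 1 \<le> k \<Longrightarrow> k \<le> c \<Longrightarrow>
      specification_property (characters (ilcs_factor G k)) (d k)
        (dual_map (ilcs_factor G k) (induced_map \<phi>))"
  shows "has_growth_rate G \<phi>
    (ereal_exp (\<Sum>k=1..c.
       topological_entropy (characters (ilcs_factor G k)) (d k)
         (dual_map (ilcs_factor G k) (induced_map \<phi>))))"
proof -
  interpret group G by fact
  note tame = assms(8) and expansive = assms(9) and spec = assms(10)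
  let ?N = "isolated_lcs G"
  let ?h = "\<lambda>k. topological_entropy (characters (ilcs_factor G k)) (d k) (dual_map (ilcs_factor G k) (induced_map \<phi>))"
  have \<phi>: "\<phi> \<in> hom G G" using assms(5) by (simp add: iso_def)
  have \<phi>N: "\<phi> ` ?N k = ?N k" if "1 \<le> k" for k by (rule isolated_lcs_iso_image[OF assms(5) that])
  have factor: "comm_group (ilcs_factor G k)" "induced_map \<phi> \<in> hom (ilcs_factor G k) (ilcs_factor G k)"
    if "1 \<le> k" for k
    by (rule ilcs_factor_comm_group[OF that], rule ilcs_factor_induced_hom[OF \<phi> \<phi>N that])
  have "\<exists>p. \<forall>k\<in>{1..c}. (\<forall>n\<ge>1. reidemeister (ilcs_factor G k) (induced_map \<phi> ^^ n) = enat (p k n) \<and> 1 \<le> p k n) \<and>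
      (\<lambda>n. ereal (ln (real (p k n)) / real n)) \<longlonglongrightarrow> ?h k"
  proof (intro bchoice ballI)
    fix k assume "k \<in> {1..c}"
    then have k: "1 \<le> k" "k \<le> c" by auto
    interpret Q: comm_group "ilcs_factor G k" by (rule factor(1)[OF k(1)])
    show "\<exists>p. (\<forall>n\<ge>1. reidemeister (ilcs_factor G k) (induced_map \<phi> ^^ n) = enat (p n) \<and> 1 \<le> p n) \<and>
      (\<lambda>n. ereal (ln (real (p n)) / real n)) \<longlonglongrightarrow> ?h k"
      by (rule Q.reidemeister_entropy[OF factor(2)[OF k(1)] tame[OF k] metric[OF k] expansive[OF k] spec[OF k]])
  qed
  then obtain p where p: "\<forall>k\<in>{1..c}. (\<forall>n\<ge>1. reidemeister (ilcs_factor G k) (induced_map \<phi> ^^ n) = enat (p k n) \<and> 1 \<le> p k n) \<and>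
      (\<lambda>n. ereal (ln (real (p k n)) / real n)) \<longlonglongrightarrow> ?h k" by (elim exE) (rule that)
  have prod: "reidemeister G (\<phi> ^^ n) = enat (\<Prod>k=1..c. p k n)" if n: "1 \<le> n" for n
  proof (rule reidemeister_isolated_lcs[OF assms(3,4) funpow_hom[OF \<phi>]])
    show "(\<phi> ^^ n) ` ?N k = ?N k" if "1 \<le> k" for k
      by (induction n) (use \<phi>N[OF that] in \<open>simp_all flip: image_image\<close>)
    fix k assume k: "1 \<le> k" "k \<le> c"
    interpret Q: comm_group "ilcs_factor G k" by (rule factor(1)[OF k(1)])
    show "C = \<one>\<^bsub>ilcs_factor G k\<^esub>" if "C \<in> carrier (ilcs_factor G k)" "induced_map (\<phi> ^^ n) C = C" for C
      using Q.periodic_element_trivial[OF factor(2)[OF k(1)] metric[OF k] compatible[OF k] spec[OF k] that(1) _ n] that(2)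
      by (simp add: induced_map_funpow)
    show "reidemeister (ilcs_factor G k) (induced_map (\<phi> ^^ n)) = enat (p k n)"
      using p n k by (simp flip: induced_map_funpow)
  qed
  have "(\<lambda>n. ereal (root n (real (\<Prod>k=1..c. p k n)))) \<longlonglongrightarrow> ereal_exp (\<Sum>k=1..c. ?h k)"
    by (rule root_prod_tendsto) (use p in auto)
  moreover have "eventually (\<lambda>n. ereal (root n (real (\<Prod>k=1..c. p k n))) = enat_root n (reidemeister G (\<phi> ^^ n))) sequentially"
    using eventually_ge_at_top[of 1] by eventually_elim (simp only: prod enat_root_def enat.case)
  ultimately show ?thesis
    unfolding has_growth_rate_def by (rule Lim_transform_eventually)
qed

end
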